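(* There exists a small (i.e., set-sized) complete Boolean algebra whose coproduct with itself, taken in the category of possibly large (proper-class-sized) complete Boolean algebras and complete Boolean homomorphisms, is large (a proper class).
   Context: Complete Boolean algebras may be allowed to have a proper class as underlying collection ("large"); "small" means the underlying collection is a set. The coproduct of two complete Boolean algebras always exists in the category of possibly large complete Boolean algebras (e.g., via equivalence classes of complete Boolean terms). *)

theory Defs
  imports "HOL-Algebra.Lattice" "HOL-Library.Equipollence"
begin

text \<open>
  HOL has no proper classes. A type \<open>'u\<close> plays the role of the class of all sets and
  \<open>'u set\<close> that of the collection of all classes. As in von Neumann's axiom of limitation
  of size, a class is a set (is \<^emph>\<open>small\<close>) iff it has fewer elements than the universe.
\<close>

definition small :: "'u set \<Rightarrow> bool"
  where "small A \<longleftrightarrow> A \<prec> (UNIV :: 'u set)"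

text \<open>
  Infinity, power set and union; replacement and separation are automatic for a notion of
  smallness given by cardinality. Together they say that the cardinality of \<open>'u\<close> is strongly
  inaccessible.
\<close>

definition set_universe :: "'u itself \<Rightarrow> bool"
  where "set_universe TYPE('u) \<longleftrightarrow>
    (UNIV :: nat set) \<prec> (UNIV :: 'u set) \<and>
    (\<forall>A :: 'u set. small A \<longrightarrow> Pow A \<prec> (UNIV :: 'u set)) \<and>
    (\<forall>F :: 'u set set. F \<prec> (UNIV :: 'u set) \<and> (\<forall>A\<in>F. small A) \<longrightarrow> small (\<Union>F))"

definition is_complement :: "('a, 'm) gorder_scheme \<Rightarrow> 'a \<Rightarrow> 'a \<Rightarrow> bool"
  where "is_complement L x y \<longleftrightarrow>
    x \<in> carrier L \<and> y \<in> carrier L \<and>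
    x \<squnion>\<^bsub>L\<^esub> y = \<top>\<^bsub>L\<^esub> \<and> x \<sqinter>\<^bsub>L\<^esub> y = \<bottom>\<^bsub>L\<^esub>"

locale boolean_lattice = bounded_lattice L for L (structure) +
  assumes meet_join_distrib:
      "\<lbrakk>x \<in> carrier L; y \<in> carrier L; z \<in> carrier L\<rbrakk>
        \<Longrightarrow> x \<sqinter> (y \<squnion> z) = (x \<sqinter> y) \<squnion> (x \<sqinter> z)"
    and complement_exists: "x \<in> carrier L \<Longrightarrow> \<exists>y. is_complement L x y"

text \<open>
  A possibly large complete Boolean algebra: the carrier is an arbitrary class, and joins and
  meets exist for all subclasses of the carrier that are sets. If the carrier is itself small,
  this is completeness in the usual sense.
\<close>

locale complete_boolean_lattice = boolean_lattice L for L (structure) +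
  assumes small_sup_exists: "\<lbrakk>A \<subseteq> carrier L; small A\<rbrakk> \<Longrightarrow> \<exists>s. is_lub L s A"
    and small_inf_exists: "\<lbrakk>A \<subseteq> carrier L; small A\<rbrakk> \<Longrightarrow> \<exists>i. is_glb L i A"

definition complete_boolean_hom :: "'u gorder \<Rightarrow> 'u gorder \<Rightarrow> ('u \<Rightarrow> 'u) set"
  where "complete_boolean_hom L M =
    {h. h \<in> carrier L \<rightarrow> carrier M \<and>
        (\<forall>x y. is_complement L x y \<longrightarrow> is_complement M (h x) (h y)) \<and>
        (\<forall>A. A \<subseteq> carrier L \<and> small A \<longrightarrow>
           h (\<Squnion>\<^bsub>L\<^esub> A) = \<Squnion>\<^bsub>M\<^esub> (h ` A) \<and> h (\<Sqinter>\<^bsub>L\<^esub> A) = \<Sqinter>\<^bsub>M\<^esub> (h ` A))}"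

text \<open>
  Homomorphisms only matter on the carrier, so uniqueness of the mediating map is equality there.
\<close>

definition is_coproduct ::
    "'u gorder \<Rightarrow> 'u gorder \<Rightarrow> 'u gorder \<Rightarrow> ('u \<Rightarrow> 'u) \<Rightarrow> ('u \<Rightarrow> 'u) \<Rightarrow> bool"
  where "is_coproduct A B C i j \<longleftrightarrow>
    complete_boolean_lattice C \<and>
    i \<in> complete_boolean_hom A C \<and> j \<in> complete_boolean_hom B C \<and>
    (\<forall>D f g. complete_boolean_lattice D \<and>
       f \<in> complete_boolean_hom A D \<and> g \<in> complete_boolean_hom B D \<longrightarrow>
       (\<exists>h \<in> complete_boolean_hom C D.
          (\<forall>x\<in>carrier A. h (i x) = f x) \<and> (\<forall>x\<in>carrier B. h (j x) = g x) \<and>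
          (\<forall>h' \<in> complete_boolean_hom C D.
             (\<forall>x\<in>carrier A. h' (i x) = f x) \<and> (\<forall>x\<in>carrier B. h' (j x) = g x) \<longrightarrow>
             (\<forall>z\<in>carrier C. h' z = h z))))"

end

theory Submission
  imports Defs
begin

text \<open>
  Take for \<open>B\<close> the algebra of regular open sets of the Cohen forcing whose conditions are finite
  square Boolean matrices. Given a well-ordered set \<open>Y\<close>, consider conditions consisting of a finite
  sequence \<open>s\<close> in \<open>Y\<close> and a matrix \<open>M\<close> of the same size. Both \<open>M\<close> and the
  matrix \<open>M i j \<noteq> (s i < s j)\<close> are Cohen generic, so they give two complete homomorphisms from
  \<open>B\<close> to the algebra \<open>D\<close> of these conditions. From the two matrices together one recovers the
  Boolean values of \<open>s i < s j\<close>, and then, by recursion on \<open>a\<close> since the generic sequence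
  enumerates \<open>Y\<close>, those of \<open>s m = a\<close>. Hence the image of the coproduct in \<open>D\<close> has at
  least \<open>|Y|\<close> elements. The coproduct itself is the algebra of complete Boolean terms modulo equality
  of all their interpretations; it fits into the universe because an inaccessible cardinal \<open>\<kappa>\<close>
  has only \<open>\<kappa>\<close> subsets of smaller size.
\<close>

section \<open>Cardinality in a universe of sets\<close>

text \<open>The obstacle is that \<open>B\<close> is fixed while \<open>Y\<close> may be arbitrarily
  large, so neither factor alone can carry information about \<open>Y\<close>: each matrix by itself
  is just a Cohen matrix, and everything sits in the correlation of the two, which the coproduct
  retains. The twist by the order is invisible to either factor because \<open>M\<close> is free:
  whatever extension of one of the two matrices is wanted, the new part of \<open>M\<close> can be
  chosen to produce it. The pair, however, codes a prewellorder of the natural numbers of the length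
  of \<open>Y\<close>, so \<open>Y\<close> is collapsed to a countable set. A well-order is chosen
  because its elements can be recovered by recursion from the order relation alone. Largeness is
  shown by contradiction: \<open>D\<close> depends on \<open>Y\<close>, and against a coproduct
  supposed to be small a small \<open>Y\<close> with more elements is chosen afterwards. Since
  homomorphisms and coproducts live on the single type \<open>'u\<close>, every algebra in the
  argument, including the term algebra, has to be coded by elements of \<open>'u\<close>; this is
  where the cardinal arithmetic is spent.\<close>

lemma lepoll_iff_ordLeq: "A \<lesssim> B \<longleftrightarrow> (card_of A, card_of B) \<in> ordLeq"
  unfolding lepoll_def card_of_ordLeq[symmetric] by simp

lemma lesspoll_if_ordLess: "(card_of A, card_of B) \<in> ordLess \<Longrightarrow> A \<prec> B"
  using not_ordLess_ordLeq[of "card_of A" "card_of B"] ordLess_imp_ordLeq[of "card_of A" "card_of B"]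
    eqpoll_imp_lepoll[OF eqpoll_sym, of A B]
  unfolding lesspoll_def lepoll_iff_ordLeq by blast

lemma small_subset: "\<lbrakk>small B; A \<subseteq> B\<rbrakk> \<Longrightarrow> small A"
  unfolding small_def by (meson lesspoll_trans1 subset_imp_lepoll)

lemma small_image:
  fixes f :: "'u \<Rightarrow> 'u"
  shows "small A \<Longrightarrow> small (f ` A)"
  unfolding small_def by (meson image_lepoll lesspoll_trans1)

lemma finite_imp_small:
  fixes A :: "'u set"
  shows "\<lbrakk>infinite (UNIV :: 'u set); finite A\<rbrakk> \<Longrightarrow> small A"
  unfolding small_def by (rule finite_lesspoll_infinite)

lemma set_universe_infinite: "set_universe TYPE('u) \<Longrightarrow> infinite (UNIV :: 'u set)"
  unfolding set_universe_def by (meson infinite_le_lepoll lesspoll_imp_lepoll)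

lemma set_universe_Union:
  fixes F :: "'u set set"
  assumes "set_universe TYPE('u)" "F \<prec> (UNIV :: 'u set)" "\<And>A. A \<in> F \<Longrightarrow> small A"
  shows "small (\<Union> F)"
  using assms unfolding set_universe_def by simp

lemma set_universe_Pow:
  fixes X :: "'a set"
  assumes u: "set_universe TYPE('u)" and X: "X \<prec> (UNIV :: 'u set)"
  shows "Pow X \<prec> (UNIV :: 'u set)"
proof -
  obtain f :: "'a \<Rightarrow> 'u" where f: "inj_on f X"
    using lesspoll_imp_lepoll[OF X] unfolding lepoll_def by blast
  have "small (f ` X)"
    unfolding small_def using X f by simp
  then have "Pow (f ` X) \<prec> (UNIV :: 'u set)"
    using u unfolding set_universe_def by simp
  moreover have "Pow X \<lesssim> Pow (f ` X)"
    unfolding lepoll_def using inj_on_image_Pow[OF f] image_Pow_surj[OF refl, of f X]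
    by (intro exI[of _ "image f"]) simp
  ultimately show ?thesis
    by (rule lesspoll_trans1[rotated])
qed

lemma Times_UNIV_lepoll:
  assumes "infinite (UNIV :: 'u set)"
  shows "(UNIV :: ('u \<times> 'u) set) \<lesssim> (UNIV :: 'u set)"
  using card_of_Times_same_infinite[OF assms]
  by (simp add: eqpoll_iff_card_of_ordIso[symmetric] eqpoll_imp_lepoll)

lemma set_universe_Times:
  fixes X :: "'a set" and Y :: "'b set"
  assumes u: "set_universe TYPE('u)" and X: "X \<prec> (UNIV :: 'u set)" and Y: "Y \<prec> (UNIV :: 'u set)"
  shows "X \<times> Y \<prec> (UNIV :: 'u set)"
proof -
  let ?U = "UNIV :: 'u set"
  obtain f :: "'a \<Rightarrow> 'u" and g :: "'b \<Rightarrow> 'u" where f: "inj_on f X" and g: "inj_on g Y"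
    using X[THEN lesspoll_imp_lepoll] Y[THEN lesspoll_imp_lepoll] unfolding lepoll_def by blast
  obtain p :: "'u \<times> 'u \<Rightarrow> 'u" where p: "inj p"
    using Times_UNIV_lepoll[OF set_universe_infinite[OF u]] unfolding lepoll_def by blast
  \<comment> \<open>The product is coded as the union of its sections over the elements of
    \<open>X\<close>: fewer than \<open>|'u|\<close> many sets, each small.\<close>
  let ?F = "(\<lambda>a. (\<lambda>y. p (f a, g y)) ` Y) ` X"
  have "small (\<Union> ?F)"
  proof (rule set_universe_Union[OF u])
    show "?F \<prec> ?U"
      by (rule lesspoll_trans1[OF image_lepoll X])
    show "small A" if "A \<in> ?F" for A
      using lesspoll_trans1[OF image_lepoll Y] that unfolding small_def by auto
  qed
  moreover have "X \<times> Y \<lesssim> \<Union> ?F"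
    unfolding lepoll_def
  proof (intro exI conjI)
    show "inj_on (\<lambda>(x, y). p (f x, g y)) (X \<times> Y)"
      using f g p unfolding inj_on_def by fast
    show "(\<lambda>(x, y). p (f x, g y)) ` (X \<times> Y) \<subseteq> \<Union> ?F"
      by auto
  qed
  ultimately show ?thesis
    unfolding small_def by (rule lesspoll_trans1[rotated])
qed

text \<open>By regularity every small set lies below some element of the initial well-order.\<close>

lemma small_sets_lepoll:
  assumes u: "set_universe TYPE('u)"
  shows "{A :: 'u set. small A} \<lesssim> (UNIV :: 'u set)"
proof -
  let ?U = "UNIV :: 'u set"
  let ?r = "card_of ?U"
  have co: "Card_order ?r" and fld: "Field ?r = ?U"
    by (rule card_of_Card_order, rule Field_card_of)
  interpret r: wo_rel ?r
    by (simp add: wo_rel_def card_of_Well_order)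
  have seg: "small (underS ?r a)" for a
    using lesspoll_if_ordLess[OF card_of_underS[OF co, of a]] fld unfolding small_def by simp
  have bounded: "\<exists>a. A \<subseteq> underS ?r a" if A: "small A" for A
  proof (rule ccontr)
    assume no: "\<nexists>a. A \<subseteq> underS ?r a"
    \<comment> \<open>A small set not contained in any initial segment would be cofinal, and the
      universe would be a small union of small closed segments.\<close>
    have "?U \<subseteq> \<Union> ((\<lambda>a. insert a (underS ?r a)) ` A)"
    proof
      fix x
      obtain a where a: "a \<in> A" "a \<notin> underS ?r x" using no by blast
      have "x = a \<or> x \<in> underS ?r a"
        using a(2) r.TOTALS fld unfolding underS_def by auto
      with a(1) show "x \<in> \<Union> ((\<lambda>a. insert a (underS ?r a)) ` A)" by blast
    qed
    moreover have "small (\<Union> ((\<lambda>a. insert a (underS ?r a)) ` A))"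
    proof -
      have "small (insert a (underS ?r a))" for a
      proof (cases "finite (underS ?r a)")
        case True
        then show ?thesis by (simp add: finite_imp_small set_universe_infinite[OF u])
      next
        case False
        show ?thesis
          unfolding small_def
          by (rule lesspoll_trans1[OF infinite_insert_lepoll[OF False] seg[unfolded small_def]])
      qed
      moreover have "(\<lambda>a. insert a (underS ?r a)) ` A \<prec> ?U"
        using lesspoll_trans1[OF image_lepoll] A unfolding small_def .
      ultimately show ?thesis
        by (intro set_universe_Union[OF u]) auto
    qed
    ultimately have "small ?U" by (rule small_subset[rotated])
    then show False unfolding small_def by simp
  qed
  \<comment> \<open>Each segment has fewer than \<open>|'u|\<close> subsets by the power set axiom,
    so \<open>|'u|\<close> many segments account for at most \<open>|'u|\<close> small sets.\<close>
  have "{A. small A} \<subseteq> (\<Union>a. Pow (underS ?r a))"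
    using bounded by blast
  moreover have "(\<Union>a\<in>?U. Pow (underS ?r a)) \<lesssim> ?U"
  proof -
    have "\<forall>a\<in>?U. (card_of (Pow (underS ?r a)), ?r) \<in> ordLeq"
    proof
      fix a :: 'u
      have "Pow (underS ?r a) \<prec> ?U"
        by (rule set_universe_Pow[OF u seg[unfolded small_def]])
      then show "(card_of (Pow (underS ?r a)), ?r) \<in> ordLeq"
        by (simp only: lesspoll_imp_lepoll lepoll_iff_ordLeq[symmetric])
    qed
    then show ?thesis
      unfolding lepoll_iff_ordLeq
      by (intro card_of_UNION_ordLeq_infinite set_universe_infinite[OF u] card_of_mono1) auto
  qed
  ultimately show ?thesis
    by (rule lepoll_trans[OF subset_imp_lepoll])
qed

section \<open>Complete Boolean algebras via complementation\<close>

lemma is_lub_iff: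
  assumes "A \<subseteq> carrier L"
  shows "is_lub L s A \<longleftrightarrow> s \<in> carrier L \<and> (\<forall>a\<in>A. a \<sqsubseteq>\<^bsub>L\<^esub> s) \<and>
    (\<forall>v\<in>carrier L. (\<forall>a\<in>A. a \<sqsubseteq>\<^bsub>L\<^esub> v) \<longrightarrow> s \<sqsubseteq>\<^bsub>L\<^esub> v)"
  using assms unfolding least_def Upper_def by blast

lemma is_glb_iff:
  assumes "A \<subseteq> carrier L"
  shows "is_glb L s A \<longleftrightarrow> s \<in> carrier L \<and> (\<forall>a\<in>A. s \<sqsubseteq>\<^bsub>L\<^esub> a) \<and>
    (\<forall>v\<in>carrier L. (\<forall>a\<in>A. v \<sqsubseteq>\<^bsub>L\<^esub> a) \<longrightarrow> v \<sqsubseteq>\<^bsub>L\<^esub> s)"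
  using assms unfolding greatest_def Lower_def by blast

lemma (in partial_order) sup_eqI: "is_lub L s A \<Longrightarrow> \<Squnion> A = s"
  unfolding sup_def by (metis (mono_tags, lifting) least_unique someI)

lemma (in partial_order) inf_eqI: "is_glb L s A \<Longrightarrow> \<Sqinter> A = s"
  unfolding inf_def by (metis (mono_tags, lifting) greatest_unique someI)

text \<open>
  An order-theoretic presentation of complete Boolean algebras that needs no lattice
  operations: an order-reversing involution which is a complementation, and separativity.
\<close>

locale complemented_order = partial_order L for L :: "'u gorder" (structure) +
  fixes N :: "'u \<Rightarrow> 'u"
  assumes infinite_universe: "infinite (UNIV :: 'u set)"
    and N_closed: "x \<in> carrier L \<Longrightarrow> N x \<in> carrier L"
    and N_N: "x \<in> carrier L \<Longrightarrow> N (N x) = x"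
    and N_antimono: "\<lbrakk>x \<in> carrier L; y \<in> carrier L; x \<sqsubseteq> y\<rbrakk> \<Longrightarrow> N y \<sqsubseteq> N x"
    and N_disjoint: "\<lbrakk>x \<in> carrier L; y \<in> carrier L; z \<in> carrier L; z \<sqsubseteq> x; z \<sqsubseteq> N x\<rbrakk> \<Longrightarrow> z \<sqsubseteq> y"
    and separative: "\<lbrakk>x \<in> carrier L; y \<in> carrier L;
        \<And>w v. \<lbrakk>w \<in> carrier L; v \<in> carrier L; w \<sqsubseteq> x; w \<sqsubseteq> N y\<rbrakk> \<Longrightarrow> w \<sqsubseteq> v\<rbrakk> \<Longrightarrow> x \<sqsubseteq> y"
    and small_lub_exists: "\<lbrakk>A \<subseteq> carrier L; small A\<rbrakk> \<Longrightarrow> \<exists>s. is_lub L s A"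
begin

lemma N_le_swap: "\<lbrakk>x \<in> carrier L; y \<in> carrier L; x \<sqsubseteq> N y\<rbrakk> \<Longrightarrow> y \<sqsubseteq> N x"
  using N_antimono[of x "N y"] N_closed N_N by simp

lemma N_le_swap': "\<lbrakk>x \<in> carrier L; y \<in> carrier L; N x \<sqsubseteq> y\<rbrakk> \<Longrightarrow> N y \<sqsubseteq> x"
  using N_antimono[of "N x" y] N_closed N_N by simp

text \<open>De Morgan: an order-reversing involution carries least upper bounds to greatest lower
  bounds, so completeness need be assumed for joins only.\<close>

lemma is_glb_N:
  assumes A: "A \<subseteq> carrier L" and s: "is_lub L s (N ` A)"
  shows "is_glb L (N s) A"
proof -
  have NA: "N ` A \<subseteq> carrier L" using A N_closed by blast
  have sc: "s \<in> carrier L" and above: "\<And>a. a \<in> A \<Longrightarrow> N a \<sqsubseteq> s"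
    and least: "\<And>v. \<lbrakk>v \<in> carrier L; \<And>a. a \<in> A \<Longrightarrow> N a \<sqsubseteq> v\<rbrakk> \<Longrightarrow> s \<sqsubseteq> v"
    using s unfolding is_lub_iff[OF NA] by auto
  show ?thesis
    unfolding is_glb_iff[OF A]
  proof (intro conjI ballI impI)
    show "N s \<in> carrier L" by (rule N_closed[OF sc])
  next
    fix a assume "a \<in> A"
    then show "N s \<sqsubseteq> a" using above sc A by (auto intro!: N_le_swap'[of a s])
  next
    fix v assume v: "v \<in> carrier L" "\<forall>a\<in>A. v \<sqsubseteq> a"
    then have "s \<sqsubseteq> N v" using A by (intro least N_closed N_antimono) auto
    then show "v \<sqsubseteq> N s" by (rule N_le_swap[OF sc v(1)])
  qed
qed

lemma small_pair: "small {x, y :: 'u}"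
  by (rule finite_imp_small[OF infinite_universe]) simp

lemma small_empty: "small ({} :: 'u set)"
  by (rule finite_imp_small[OF infinite_universe]) simp

lemma is_lub_sup: "\<lbrakk>A \<subseteq> carrier L; small A\<rbrakk> \<Longrightarrow> is_lub L (\<Squnion> A) A"
  using small_lub_exists sup_eqI by metis

lemma
  assumes A: "A \<subseteq> carrier L" "small A"
  shows is_glb_inf: "is_glb L (\<Sqinter> A) A"
    and inf_eq_N_sup: "\<Sqinter> A = N (\<Squnion> (N ` A))"
proof -
  have "N ` A \<subseteq> carrier L" "small (N ` A)"
    using A N_closed by (auto intro: small_image)
  then have *: "is_glb L (N (\<Squnion> (N ` A))) A"
    by (intro is_glb_N[OF A(1)] is_lub_sup)
  then show "\<Sqinter> A = N (\<Squnion> (N ` A))"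
    by (rule inf_eqI)
  with * show "is_glb L (\<Sqinter> A) A"
    by simp
qed

sublocale bounded_lattice L
proof
  fix x y assume "x \<in> carrier L" "y \<in> carrier L"
  then show "\<exists>s. is_lub L s {x, y}" "\<exists>s. is_glb L s {x, y}"
    using is_lub_sup[OF _ small_pair, of x y] is_glb_inf[OF _ small_pair, of x y] by auto
next
  show "\<exists>x. least L x (carrier L)" using is_lub_sup[of "{}"] small_empty by auto
  show "\<exists>x. greatest L x (carrier L)" using is_glb_inf[of "{}"] small_empty by auto
qed

text \<open>Complements are unique, so the relation in the definition of homomorphisms becomes the
  function \<open>N\<close>. Throughout, "below every \<open>v\<close>" is how an element is said to
  be zero.\<close>

lemma is_complement_iff: "is_complement L x y \<longleftrightarrow> x \<in> carrier L \<and> y = N x"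
proof
  assume "is_complement L x y"
  then have x: "x \<in> carrier L" and y: "y \<in> carrier L" and j: "x \<squnion> y = \<top>" and m: "x \<sqinter> y = \<bottom>"
    unfolding is_complement_def by auto
  have "y \<sqsubseteq> N x"
  proof (rule separative)
    fix w v assume w: "w \<in> carrier L" "v \<in> carrier L" "w \<sqsubseteq> y" "w \<sqsubseteq> N (N x)"
    then have "w \<sqsubseteq> x \<sqinter> y" using x y by (simp add: N_N meet_le)
    then show "w \<sqsubseteq> v" using m w le_trans[of w \<bottom> v] bottom_lower by auto
  qed (use x y N_closed in auto)
  \<comment> \<open>An element disjoint from both \<open>x\<close> and \<open>y\<close> has a
    complement above their join, which is the top; so it is disjoint from itself.\<close>
  moreover have "N x \<sqsubseteq> y"
  proof (rule separative)
    fix w v assume w: "w \<in> carrier L" "v \<in> carrier L" "w \<sqsubseteq> N x" "w \<sqsubseteq> N y"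
    then have "x \<sqsubseteq> N w" "y \<sqsubseteq> N w" using N_le_swap x y by auto
    then have "\<top> \<sqsubseteq> N w" using join_le[of x "N w" y] j x y w N_closed by simp
    then have "w \<sqsubseteq> N w" using w le_trans[of w \<top> "N w"] top_higher N_closed by auto
    then show "w \<sqsubseteq> v" using N_disjoint[of w v w] w by auto
  qed (use x y N_closed in auto)
  ultimately show "x \<in> carrier L \<and> y = N x" using x y N_closed le_antisym by blast
next
  assume "x \<in> carrier L \<and> y = N x"
  then have x: "x \<in> carrier L" and y: "y = N x" by auto
  note Nx = N_closed[OF x]
  have "\<top> \<sqsubseteq> x \<squnion> N x"
  proof (rule separative)
    fix w v assume w: "w \<in> carrier L" "v \<in> carrier L" "w \<sqsubseteq> N (x \<squnion> N x)"
    then have *: "x \<squnion> N x \<sqsubseteq> N w" using x Nx by (simp add: N_le_swap)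
    have "x \<sqsubseteq> N w" "N x \<sqsubseteq> N w"
      using * x Nx w le_trans[OF join_left *] le_trans[OF join_right *] N_closed by auto
    then have "w \<sqsubseteq> N x" "w \<sqsubseteq> x"
      using x Nx w N_le_swap[of x w] N_le_swap[of "N x" w] by (auto simp: N_N)
    then show "w \<sqsubseteq> v" using N_disjoint[of x v w] x w by auto
  qed (use x Nx in auto)
  then have "x \<squnion> N x = \<top>" using x Nx by (meson join_closed le_antisym top_closed top_higher)
  moreover have "x \<sqinter> N x \<sqsubseteq> \<bottom>"
    using N_disjoint[of x \<bottom> "x \<sqinter> N x"] x Nx meet_left meet_right by auto
  then have "x \<sqinter> N x = \<bottom>" using x Nx by (meson meet_closed le_antisym bottom_closed bottom_lower)
  ultimately show "is_complement L x y" unfolding is_complement_def using x y Nx by simp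
qed

sublocale complete_boolean_lattice L
proof
  fix x y z assume x: "x \<in> carrier L" and y: "y \<in> carrier L" and z: "z \<in> carrier L"
  let ?d = "(x \<sqinter> y) \<squnion> (x \<sqinter> z)"
  have cl: "x \<sqinter> y \<in> carrier L" "x \<sqinter> z \<in> carrier L" "?d \<in> carrier L" "x \<sqinter> (y \<squnion> z) \<in> carrier L"
    "y \<squnion> z \<in> carrier L" using x y z by auto
  have "x \<sqinter> (y \<squnion> z) \<sqsubseteq> ?d"
  proof (rule separative)
    fix w v assume w: "w \<in> carrier L" "v \<in> carrier L" "w \<sqsubseteq> x \<sqinter> (y \<squnion> z)" "w \<sqsubseteq> N ?d"
    have wx: "w \<sqsubseteq> x" and wyz: "w \<sqsubseteq> y \<squnion> z"
      using w cl x le_trans[OF w(3) meet_left] le_trans[OF w(3) meet_right] by auto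
    \<comment> \<open>Since \<open>w\<close> lies below \<open>x\<close> and is disjoint from
      \<open>?d\<close>, anything whose meet with \<open>x\<close> lies in \<open>?d\<close> is
      disjoint from \<open>w\<close>. For \<open>y\<close> and \<open>z\<close> this makes
      \<open>y \<squnion> z\<close> disjoint from \<open>w\<close>, although \<open>w\<close> lies
      below it, so \<open>w\<close> is zero.\<close>
    have "t \<sqsubseteq> N w" if t: "t \<in> carrier L" "x \<sqinter> t \<sqsubseteq> ?d" for t
    proof (rule separative)
      fix u v assume u: "u \<in> carrier L" "v \<in> carrier L" "u \<sqsubseteq> t" "u \<sqsubseteq> N (N w)"
      then have uw: "u \<sqsubseteq> w" using w by (simp add: N_N)
      then have "u \<sqsubseteq> x \<sqinter> t" using u w x t wx le_trans[OF uw wx] by (simp add: meet_le)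
      then have "u \<sqsubseteq> ?d" using u t x cl by (meson le_trans meet_closed)
      moreover have "u \<sqsubseteq> N ?d" using uw w u cl N_closed le_trans by blast
      ultimately show "u \<sqsubseteq> v" using N_disjoint u cl by blast
    qed (use t w N_closed in auto)
    from this[OF y] this[OF z] have "y \<squnion> z \<sqsubseteq> N w"
      using join_left[OF cl(1,2)] join_right[OF cl(1,2)] y z w N_closed by (simp add: join_le)
    then have "w \<sqsubseteq> N w" using wyz cl w N_closed le_trans by blast
    then show "w \<sqsubseteq> v" using N_disjoint[of w v w] w by auto
  qed (use cl in auto)
  moreover have "?d \<sqsubseteq> x \<sqinter> (y \<squnion> z)"
  proof (rule join_le)
    show "x \<sqinter> y \<sqsubseteq> x \<sqinter> (y \<squnion> z)"
      using x y z cl by (meson join_left le_trans meet_le meet_left meet_right)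
    show "x \<sqinter> z \<sqsubseteq> x \<sqinter> (y \<squnion> z)"
      using x y z cl by (meson join_right le_trans meet_le meet_left meet_right)
  qed (use cl in auto)
  ultimately show "x \<sqinter> (y \<squnion> z) = ?d" using cl by (simp add: le_antisym)
next
  fix x assume "x \<in> carrier L"
  then show "\<exists>y. is_complement L x y" using is_complement_iff by blast
next
  fix A assume "A \<subseteq> carrier L" "small A"
  then show "\<exists>s. is_lub L s A" "\<exists>i. is_glb L i A" using is_lub_sup is_glb_inf by blast+
qed

end

definition complement :: "'u gorder \<Rightarrow> 'u \<Rightarrow> 'u"
  where "complement L x = (SOME y. is_complement L x y)"

text \<open>The converse passage: arbitrary targets \<open>D\<close> in the universal property can
  now be handled through the order and the complement alone.\<close>

lemma complete_boolean_lattice_imp_complemented_order: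
  fixes L :: "'u gorder"
  assumes inf: "infinite (UNIV :: 'u set)" and L: "complete_boolean_lattice L"
  shows "complemented_order L (complement L)"
proof -
  interpret complete_boolean_lattice L by fact
  have c: "is_complement L x (complement L x)" if "x \<in> carrier L" for x
    using complement_exists[OF that] unfolding complement_def by (rule someI_ex)
  have cl: "complement L x \<in> carrier L" if "x \<in> carrier L" for x
    using c[OF that] unfolding is_complement_def by blast
  have j: "x \<squnion>\<^bsub>L\<^esub> complement L x = \<top>\<^bsub>L\<^esub>" and m: "x \<sqinter>\<^bsub>L\<^esub> complement L x = \<bottom>\<^bsub>L\<^esub>"
    if "x \<in> carrier L" for x
    using c[OF that] unfolding is_complement_def by auto
  have meet_comm: "x \<sqinter>\<^bsub>L\<^esub> y = y \<sqinter>\<^bsub>L\<^esub> x" for x y unfolding meet_def by (simp add: insert_commute)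
  have join_comm: "x \<squnion>\<^bsub>L\<^esub> y = y \<squnion>\<^bsub>L\<^esub> x" for x y unfolding join_def by (simp add: insert_commute)
  \<comment> \<open>Distributivity enters here: \<open>x\<close> splits into its parts in
    \<open>y\<close> and in \<open>y'\<close>, and both lie below \<open>y\<close>.\<close>
  have sep: "x \<sqsubseteq>\<^bsub>L\<^esub> y" if x: "x \<in> carrier L" and y: "y \<in> carrier L" and y': "y' \<in> carrier L"
    and top: "y \<squnion>\<^bsub>L\<^esub> y' = \<top>\<^bsub>L\<^esub>" and "x \<sqinter>\<^bsub>L\<^esub> y' \<sqsubseteq>\<^bsub>L\<^esub> y" for x y y'
  proof -
    have "x \<sqsubseteq>\<^bsub>L\<^esub> x \<sqinter>\<^bsub>L\<^esub> (y \<squnion>\<^bsub>L\<^esub> y')" using x top by (simp add: meet_le top_higher)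
    also have "\<dots> = (x \<sqinter>\<^bsub>L\<^esub> y) \<squnion>\<^bsub>L\<^esub> (x \<sqinter>\<^bsub>L\<^esub> y')" using meet_join_distrib x y y' by simp
    also have "\<dots> \<sqsubseteq>\<^bsub>L\<^esub> y" using that meet_right by (simp add: join_le)
    finally show ?thesis using x y y' by simp
  qed
  have NN: "complement L (complement L x) = x" if x: "x \<in> carrier L" for x
  proof (rule le_antisym)
    note cx = cl[OF x] cl[OF cl[OF x]]
    show "complement L (complement L x) \<sqsubseteq>\<^bsub>L\<^esub> x"
      using sep[of "complement L (complement L x)" x "complement L x"] x cx j[OF x] m[OF cx(1)]
        bottom_lower by (simp add: meet_comm)
    show "x \<sqsubseteq>\<^bsub>L\<^esub> complement L (complement L x)"
      using sep[of x "complement L (complement L x)" "complement L x"] x cx j[OF cx(1)] m[OF x]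
        bottom_lower by (simp add: join_comm)
  qed (use x cl in auto)
  have bot: "z \<sqsubseteq>\<^bsub>L\<^esub> \<bottom>\<^bsub>L\<^esub>" if "z \<in> carrier L" "x \<in> carrier L" "z \<sqsubseteq>\<^bsub>L\<^esub> x" "z \<sqsubseteq>\<^bsub>L\<^esub> complement L x" for x z
    using meet_le[of z x "complement L x"] that cl m by simp
  show ?thesis
  proof
    show "infinite (UNIV :: 'u set)" by fact
  next
    fix x y assume xy: "x \<in> carrier L" "y \<in> carrier L" "x \<sqsubseteq>\<^bsub>L\<^esub> y"
    note cxy = cl[OF xy(1)] cl[OF xy(2)]
    have "complement L y \<sqinter>\<^bsub>L\<^esub> x \<sqsubseteq>\<^bsub>L\<^esub> \<bottom>\<^bsub>L\<^esub>"
    proof (rule bot)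
      show "complement L y \<sqinter>\<^bsub>L\<^esub> x \<sqsubseteq>\<^bsub>L\<^esub> y"
        using xy cxy by (meson le_trans meet_closed meet_right)
    qed (use xy cxy meet_left in auto)
    then have "complement L y \<sqinter>\<^bsub>L\<^esub> x \<sqsubseteq>\<^bsub>L\<^esub> complement L x"
      using xy cxy by (meson bottom_closed bottom_lower le_trans meet_closed)
    then show "complement L y \<sqsubseteq>\<^bsub>L\<^esub> complement L x"
      using sep[of "complement L y" "complement L x" x] xy cxy j join_comm by simp
  next
    fix x y z assume "x \<in> carrier L" "y \<in> carrier L" "z \<in> carrier L" "z \<sqsubseteq>\<^bsub>L\<^esub> x" "z \<sqsubseteq>\<^bsub>L\<^esub> complement L x"
    then show "z \<sqsubseteq>\<^bsub>L\<^esub> y" using bot[of z x] by (meson bottom_closed bottom_lower le_trans)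
  next
    fix x y assume x: "x \<in> carrier L" and y: "y \<in> carrier L"
      and *: "\<And>w v. \<lbrakk>w \<in> carrier L; v \<in> carrier L; w \<sqsubseteq>\<^bsub>L\<^esub> x; w \<sqsubseteq>\<^bsub>L\<^esub> complement L y\<rbrakk> \<Longrightarrow> w \<sqsubseteq>\<^bsub>L\<^esub> v"
    show "x \<sqsubseteq>\<^bsub>L\<^esub> y"
    proof (rule sep[of x y "complement L y"])
      show "x \<sqinter>\<^bsub>L\<^esub> complement L y \<sqsubseteq>\<^bsub>L\<^esub> y"
        by (rule *) (use x y cl meet_left meet_right in auto)
    qed (use x y cl j in auto)
  qed (use cl NN small_sup_exists in auto)
qed

text \<open>Preservation of meets comes for free by De Morgan.\<close>

lemma complete_boolean_homI:
  assumes L: "complemented_order L N" and M: "complemented_order M N'"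
    and h: "h \<in> carrier L \<rightarrow> carrier M"
    and hN: "\<And>x. x \<in> carrier L \<Longrightarrow> h (N x) = N' (h x)"
    and hS: "\<And>A. \<lbrakk>A \<subseteq> carrier L; small A\<rbrakk> \<Longrightarrow> h (\<Squnion>\<^bsub>L\<^esub> A) = \<Squnion>\<^bsub>M\<^esub> (h ` A)"
  shows "h \<in> complete_boolean_hom L M"
proof -
  interpret L: complemented_order L N by fact
  interpret M: complemented_order M N' by fact
  have "h (\<Sqinter>\<^bsub>L\<^esub> A) = \<Sqinter>\<^bsub>M\<^esub> (h ` A)" if A: "A \<subseteq> carrier L" "small A" for A
  proof -
    have NA: "N ` A \<subseteq> carrier L" "small (N ` A)" using A L.N_closed small_image by blast+
    have hA: "h ` A \<subseteq> carrier M" "small (h ` A)" using A h small_image by blast+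
    have "h (\<Sqinter>\<^bsub>L\<^esub> A) = N' (\<Squnion>\<^bsub>M\<^esub> (h ` N ` A))"
      using L.inf_eq_N_sup[OF A] hN[of "\<Squnion>\<^bsub>L\<^esub> (N ` A)"] hS[OF NA] L.is_lub_sup[OF NA] by simp
    also have "h ` N ` A = N' ` h ` A" using A hN by (auto simp: image_iff subset_iff)
    finally show ?thesis using M.inf_eq_N_sup[OF hA] by simp
  qed
  then show ?thesis
    unfolding complete_boolean_hom_def
    using h hN hS by (auto simp: L.is_complement_iff M.is_complement_iff)
qed

lemma complete_boolean_hom_complement:
  assumes L: "complemented_order L N" and M: "complemented_order M N'"
    and h: "h \<in> complete_boolean_hom L M" and x: "x \<in> carrier L"
  shows "h (N x) = N' (h x)"
  using h x complemented_order.is_complement_iff[OF L] complemented_order.is_complement_iff[OF M]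
  unfolding complete_boolean_hom_def by blast

section \<open>Existence of coproducts\<close>

text \<open>A join is a family on an index set, since a type cannot contain all sets of its own
  elements; the values of the family off the index set are ignored. Meets are left to De
  Morgan.\<close>

datatype 'u trm = LGen 'u | RGen 'u | Cmpl "'u trm" | Join "'u set" "'u \<Rightarrow> 'u trm"

primrec trm_eval :: "'u gorder \<Rightarrow> ('u \<Rightarrow> 'u) \<Rightarrow> ('u \<Rightarrow> 'u) \<Rightarrow> 'u trm \<Rightarrow> 'u" where
  "trm_eval D f g (LGen x) = f x"
| "trm_eval D f g (RGen x) = g x"
| "trm_eval D f g (Cmpl t) = complement D (trm_eval D f g t)"
| "trm_eval D f g (Join X F) = \<Squnion>\<^bsub>D\<^esub> ((\<lambda>x. trm_eval D f g (F x)) ` X)"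

primrec wf_trm :: "'u gorder \<Rightarrow> 'u gorder \<Rightarrow> 'u trm \<Rightarrow> bool" where
  "wf_trm A B (LGen x) \<longleftrightarrow> x \<in> carrier A"
| "wf_trm A B (RGen x) \<longleftrightarrow> x \<in> carrier B"
| "wf_trm A B (Cmpl t) \<longleftrightarrow> wf_trm A B t"
| "wf_trm A B (Join X F) \<longleftrightarrow> small X \<and> (\<forall>x\<in>X. wf_trm A B (F x))"

definition cocone :: "'u gorder \<Rightarrow> 'u gorder \<Rightarrow> 'u gorder \<Rightarrow> ('u \<Rightarrow> 'u) \<Rightarrow> ('u \<Rightarrow> 'u) \<Rightarrow> bool"
  where "cocone A B D f g \<longleftrightarrow> complete_boolean_lattice D \<and>
    f \<in> complete_boolean_hom A D \<and> g \<in> complete_boolean_hom B D"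

text \<open>Semantic equality replaces the congruence generated by the Boolean laws, so most laws of
  the quotient can be checked in one interpretation at a time. The algebras ranged over are exactly
  the targets in \<open>is_coproduct\<close>.\<close>

definition trm_equiv :: "'u gorder \<Rightarrow> 'u gorder \<Rightarrow> 'u trm \<Rightarrow> 'u trm \<Rightarrow> bool"
  where "trm_equiv A B s t \<longleftrightarrow> (\<forall>D f g. cocone A B D f g \<longrightarrow> trm_eval D f g s = trm_eval D f g t)"

text \<open>A join is coded by the set of codes of its members. This forgets the indexing, so codes
  are not injective on terms, but a supremum depends only on the set of its members.\<close>

primrec trm_code :: "('u set \<Rightarrow> 'u) \<Rightarrow> (nat \<Rightarrow> 'u \<Rightarrow> 'u) \<Rightarrow> 'u trm \<Rightarrow> 'u" where
  "trm_code q p (LGen x) = p 0 x"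
| "trm_code q p (RGen x) = p 1 x"
| "trm_code q p (Cmpl t) = p 2 (trm_code q p t)"
| "trm_code q p (Join X F) = p 3 (q ((\<lambda>x. trm_code q p (F x)) ` X))"

text \<open>Induction on \<open>s\<close>: equal codes of joins give equal sets of member codes, and
  matching members by code gives equal sets of values. Well-formedness keeps these sets small, where
  \<open>q\<close> is injective.\<close>

lemma trm_code_eq_imp_eval_eq:
  assumes q: "inj_on q {X. small X}" and p: "\<And>m n x y. p m x = p n y \<longleftrightarrow> m = n \<and> x = y"
  shows "\<lbrakk>wf_trm A B s; wf_trm A B t; trm_code q p s = trm_code q p t\<rbrakk>
    \<Longrightarrow> trm_eval D f g s = trm_eval D f g t"
proof (induction s arbitrary: t)
  case (LGen x)
  then show ?case by (cases t) (simp_all add: p)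
next
  case (RGen x)
  then show ?case by (cases t) (simp_all add: p)
next
  case (Cmpl s)
  from Cmpl.prems obtain t' where t: "t = Cmpl t'" by (cases t) (simp_all add: p)
  have "trm_eval D f g s = trm_eval D f g t'"
    using Cmpl.prems t by (intro Cmpl.IH) (simp_all add: p)
  then show ?case using t by simp
next
  case (Join X F)
  from Join.prems obtain Y G where t: "t = Join Y G" by (cases t) (simp_all add: p)
  have "q ((\<lambda>x. trm_code q p (F x)) ` X) = q ((\<lambda>y. trm_code q p (G y)) ` Y)"
    using Join.prems(3) t by (simp add: p)
  moreover have "small ((\<lambda>x. trm_code q p (F x)) ` X)" "small ((\<lambda>y. trm_code q p (G y)) ` Y)"
    using Join.prems t by (auto intro: small_image)
  ultimately have im: "(\<lambda>x. trm_code q p (F x)) ` X = (\<lambda>y. trm_code q p (G y)) ` Y"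
    using inj_onD[OF q] by simp
  have ev: "trm_eval D f g (F x) = trm_eval D f g (G y)"
    if "x \<in> X" "y \<in> Y" "trm_code q p (F x) = trm_code q p (G y)" for x y
    using that Join.prems t by (intro Join.IH) simp_all
  have "(\<lambda>x. trm_eval D f g (F x)) ` X = (\<lambda>y. trm_eval D f g (G y)) ` Y"
  proof (intro equalityI image_subsetI)
    fix x assume x: "x \<in> X"
    then obtain y where "y \<in> Y" "trm_code q p (F x) = trm_code q p (G y)"
      using im by (metis (mono_tags, lifting) imageE imageI)
    then show "trm_eval D f g (F x) \<in> (\<lambda>y. trm_eval D f g (G y)) ` Y" using ev[OF x] by simp
  next
    fix y assume y: "y \<in> Y"
    then obtain x where "x \<in> X" "trm_code q p (F x) = trm_code q p (G y)"
      using im by (metis (no_types, lifting) imageE imageI)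
    then show "trm_eval D f g (G y) \<in> (\<lambda>x. trm_eval D f g (F x)) ` X"
      using ev[of x y] y by (metis imageI)
  qed
  then show ?case using t by simp
qed

lemma trm_classes_in_universe:
  fixes A B :: "'u gorder"
  assumes u: "set_universe TYPE('u)"
  shows "\<exists>cls :: 'u trm \<Rightarrow> 'u. \<forall>s t. wf_trm A B s \<longrightarrow> wf_trm A B t \<longrightarrow>
    (cls s = cls t \<longleftrightarrow> trm_equiv A B s t)"
proof -
  note inf = set_universe_infinite[OF u]
  obtain q :: "'u set \<Rightarrow> 'u" where q: "inj_on q {X. small X}"
    using small_sets_lepoll[OF u] unfolding lepoll_def by blast
  obtain p2 :: "'u \<times> 'u \<Rightarrow> 'u" where p2: "inj p2"
    using Times_UNIV_lepoll[OF inf] unfolding lepoll_def by blast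
  obtain tag :: "nat \<Rightarrow> 'u" where tag: "inj tag"
    using infinite_countable_subset[OF inf] by blast
  define code where "code = trm_code q (\<lambda>n x. p2 (tag n, x))"
  \<comment> \<open>The code identifies some terms but possibly not all equivalent ones; coding one
    chosen representative of each class makes it constant on classes.\<close>
  define r where "r t = (SOME t'. wf_trm A B t' \<and> trm_equiv A B t t')" for t
  have r: "wf_trm A B (r t) \<and> trm_equiv A B t (r t)" if "wf_trm A B t" for t
    unfolding r_def by (rule someI[of _ t]) (use that in \<open>simp add: trm_equiv_def\<close>)
  have "code (r s) = code (r t) \<longleftrightarrow> trm_equiv A B s t" if st: "wf_trm A B s" "wf_trm A B t" for s t
  proof
    assume c: "code (r s) = code (r t)"
    have "trm_eval D f g (r s) = trm_eval D f g (r t)" for D f g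
      by (rule trm_code_eq_imp_eval_eq[OF q, of "\<lambda>n x. p2 (tag n, x)" A B])
        (use r st c p2 tag in \<open>simp_all add: code_def inj_eq\<close>)
    then show "trm_equiv A B s t"
      using r st unfolding trm_equiv_def by metis
  next
    assume "trm_equiv A B s t"
    \<comment> \<open>Equivalent terms have the same class as a predicate, so the choice operator
      picks the same representative.\<close>
    then have "trm_equiv A B s = trm_equiv A B t" unfolding trm_equiv_def by (intro ext) metis
    then have "r s = r t" unfolding r_def by simp
    then show "code (r s) = code (r t)" by simp
  qed
  then show ?thesis by (intro exI[of _ "\<lambda>t. code (r t)"]) blast
qed

section \<open>The algebra of term classes and its universal property\<close>

locale coproduct_terms =
  fixes A B :: "'u gorder" and cls :: "'u trm \<Rightarrow> 'u"
  assumes infinite_UNIV: "infinite (UNIV :: 'u set)"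
    and A: "complete_boolean_lattice A" and B: "complete_boolean_lattice B"
    and cls_eq_iff: "\<lbrakk>wf_trm A B s; wf_trm A B t\<rbrakk> \<Longrightarrow> cls s = cls t \<longleftrightarrow> trm_equiv A B s t"
begin

lemma cocone_complemented: "cocone A B D f g \<Longrightarrow> complemented_order D (complement D)"
  unfolding cocone_def
  using complete_boolean_lattice_imp_complemented_order[OF infinite_UNIV] by blast

lemma eval_closed: "\<lbrakk>cocone A B D f g; wf_trm A B t\<rbrakk> \<Longrightarrow> trm_eval D f g t \<in> carrier D"
proof (induction t)
  case (LGen x)
  then show ?case unfolding cocone_def complete_boolean_hom_def by auto
next
  case (RGen x)
  then show ?case unfolding cocone_def complete_boolean_hom_def by auto
next
  case (Cmpl t)
  then show ?case using complemented_order.N_closed[OF cocone_complemented] by simp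
next
  case (Join X F)
  then have "(\<lambda>x. trm_eval D f g (F x)) ` X \<subseteq> carrier D" "small ((\<lambda>x. trm_eval D f g (F x)) ` X)"
    by (auto intro: small_image)
  then have "is_lub D (trm_eval D f g (Join X F)) ((\<lambda>x. trm_eval D f g (F x)) ` X)"
    using complemented_order.is_lub_sup[OF cocone_complemented[OF Join.prems(1)]] by simp
  then show ?case by (rule least_closed)
qed

lemma eval_Join_is_lub:
  assumes "cocone A B D f g" "wf_trm A B (Join X F)"
  shows "is_lub D (trm_eval D f g (Join X F)) ((\<lambda>x. trm_eval D f g (F x)) ` X)"
  using complemented_order.is_lub_sup[OF cocone_complemented[OF assms(1)],
      of "(\<lambda>x. trm_eval D f g (F x)) ` X"] assms eval_closed[OF assms(1)]
  by (auto intro: small_image)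

definition rep :: "'u \<Rightarrow> 'u trm"
  where "rep x = (SOME t. wf_trm A B t \<and> cls t = x)"

definition coprod :: "'u gorder"
  where "coprod = \<lparr>carrier = cls ` {t. wf_trm A B t}, eq = (=),
    le = (\<lambda>x y. \<forall>D f g. cocone A B D f g \<longrightarrow> trm_eval D f g (rep x) \<sqsubseteq>\<^bsub>D\<^esub> trm_eval D f g (rep y))\<rparr>"

definition cpl :: "'u \<Rightarrow> 'u"
  where "cpl x = cls (Cmpl (rep x))"

lemma carrier_coprod: "carrier coprod = cls ` {t. wf_trm A B t}"
  by (simp add: coprod_def)

lemma cls_closed: "wf_trm A B t \<Longrightarrow> cls t \<in> carrier coprod"
  by (simp add: carrier_coprod)

lemma rep_wf: "x \<in> carrier coprod \<Longrightarrow> wf_trm A B (rep x)"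
  and cls_rep: "x \<in> carrier coprod \<Longrightarrow> cls (rep x) = x"
proof -
  have "wf_trm A B (rep x) \<and> cls (rep x) = x" if "x \<in> carrier coprod"
    using that someI_ex[of "\<lambda>t. wf_trm A B t \<and> cls t = x"] unfolding carrier_coprod rep_def by blast
  then show "x \<in> carrier coprod \<Longrightarrow> wf_trm A B (rep x)"
    "x \<in> carrier coprod \<Longrightarrow> cls (rep x) = x" by auto
qed

lemma eval_rep_cls:
  assumes "cocone A B D f g" "wf_trm A B t"
  shows "trm_eval D f g (rep (cls t)) = trm_eval D f g t"
  using cls_eq_iff[OF rep_wf[OF cls_closed[OF assms(2)]] assms(2)] assms
    cls_rep[OF cls_closed[OF assms(2)]] unfolding trm_equiv_def by blast

lemma le_cls_iff:
  assumes "wf_trm A B s" "wf_trm A B t"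
  shows "cls s \<sqsubseteq>\<^bsub>coprod\<^esub> cls t \<longleftrightarrow>
    (\<forall>D f g. cocone A B D f g \<longrightarrow> trm_eval D f g s \<sqsubseteq>\<^bsub>D\<^esub> trm_eval D f g t)"
  using assms by (auto simp: coprod_def eval_rep_cls)

lemma cpl_cls: "wf_trm A B t \<Longrightarrow> cpl (cls t) = cls (Cmpl t)"
  unfolding cpl_def
  using rep_wf[OF cls_closed, of t] by (subst cls_eq_iff) (auto simp: trm_equiv_def eval_rep_cls)

lemma coprod_cases:
  assumes "x \<in> carrier coprod" obtains t where "wf_trm A B t" "x = cls t"
  using assms unfolding carrier_coprod by blast

lemma partial_order_coprod: "partial_order coprod"
proof
  fix x assume "x \<in> carrier coprod"
  then obtain t where t: "wf_trm A B t" "x = cls t" by (rule coprod_cases)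
  show "x \<sqsubseteq>\<^bsub>coprod\<^esub> x"
    unfolding t(2) le_cls_iff[OF t(1) t(1)]
  proof (intro allI impI)
    fix D f g assume c: "cocone A B D f g"
    interpret D: complemented_order D "complement D" by (rule cocone_complemented[OF c])
    show "trm_eval D f g t \<sqsubseteq>\<^bsub>D\<^esub> trm_eval D f g t" using eval_closed[OF c t(1)] by simp
  qed
next
  fix x y assume xy: "x \<sqsubseteq>\<^bsub>coprod\<^esub> y" "y \<sqsubseteq>\<^bsub>coprod\<^esub> x" "x \<in> carrier coprod" "y \<in> carrier coprod"
  obtain s where s: "wf_trm A B s" "x = cls s" using xy(3) by (rule coprod_cases)
  obtain t where t: "wf_trm A B t" "y = cls t" using xy(4) by (rule coprod_cases)
  have "trm_equiv A B s t"
    unfolding trm_equiv_def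
  proof (intro allI impI)
    fix D f g assume c: "cocone A B D f g"
    interpret D: complemented_order D "complement D" by (rule cocone_complemented[OF c])
    show "trm_eval D f g s = trm_eval D f g t"
      using xy(1,2) c s t eval_closed[OF c] by (auto simp: le_cls_iff intro!: D.le_antisym)
  qed
  then show "x .=\<^bsub>coprod\<^esub> y" using cls_eq_iff s t by (simp add: coprod_def)
next
  fix x y z assume xyz: "x \<sqsubseteq>\<^bsub>coprod\<^esub> y" "y \<sqsubseteq>\<^bsub>coprod\<^esub> z"
    "x \<in> carrier coprod" "y \<in> carrier coprod" "z \<in> carrier coprod"
  obtain s where s: "wf_trm A B s" "x = cls s" using xyz(3) by (rule coprod_cases)
  obtain t where t: "wf_trm A B t" "y = cls t" using xyz(4) by (rule coprod_cases)
  obtain u where u: "wf_trm A B u" "z = cls u" using xyz(5) by (rule coprod_cases)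
  show "x \<sqsubseteq>\<^bsub>coprod\<^esub> z"
    unfolding s(2) u(2) le_cls_iff[OF s(1) u(1)]
  proof (intro allI impI)
    fix D f g assume c: "cocone A B D f g"
    interpret D: complemented_order D "complement D" by (rule cocone_complemented[OF c])
    have "trm_eval D f g s \<sqsubseteq>\<^bsub>D\<^esub> trm_eval D f g t" "trm_eval D f g t \<sqsubseteq>\<^bsub>D\<^esub> trm_eval D f g u"
      using xyz(1,2) c s t u by (auto simp: le_cls_iff)
    then show "trm_eval D f g s \<sqsubseteq>\<^bsub>D\<^esub> trm_eval D f g u"
      by (rule D.le_trans) (use eval_closed[OF c] s t u in simp_all)
  qed
qed (auto simp: coprod_def)

text \<open>The order on classes is the conjunction of the orders in all interpretations, and in
  each of them the join term evaluates to the supremum of the values of its members.\<close>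

lemma is_lub_cls_Join:
  assumes XF: "wf_trm A B (Join X F)"
  shows "is_lub coprod (cls (Join X F)) ((\<lambda>x. cls (F x)) ` X)"
proof -
  have F: "wf_trm A B (F x)" if "x \<in> X" for x using XF that by simp
  have sub: "(\<lambda>x. cls (F x)) ` X \<subseteq> carrier coprod" using F cls_closed by blast
  show ?thesis
    unfolding is_lub_iff[OF sub]
  proof (intro conjI ballI impI)
    show "cls (Join X F) \<in> carrier coprod" by (rule cls_closed[OF XF])
  next
    fix a assume "a \<in> (\<lambda>x. cls (F x)) ` X"
    then obtain x where x: "x \<in> X" and a: "a = cls (F x)" by blast
    show "a \<sqsubseteq>\<^bsub>coprod\<^esub> cls (Join X F)"
      unfolding a le_cls_iff[OF F[OF x] XF]
    proof (intro allI impI)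
      fix D f g assume c: "cocone A B D f g"
      have "(\<lambda>x. trm_eval D f g (F x)) ` X \<subseteq> carrier D" using eval_closed[OF c] F by blast
      then show "trm_eval D f g (F x) \<sqsubseteq>\<^bsub>D\<^esub> trm_eval D f g (Join X F)"
        using eval_Join_is_lub[OF c XF] x by (simp only: is_lub_iff) blast
    qed
  next
    fix v assume v: "v \<in> carrier coprod" and ub: "\<forall>a\<in>(\<lambda>x. cls (F x)) ` X. a \<sqsubseteq>\<^bsub>coprod\<^esub> v"
    obtain t where t: "wf_trm A B t" "v = cls t" using v by (rule coprod_cases)
    show "cls (Join X F) \<sqsubseteq>\<^bsub>coprod\<^esub> v"
      unfolding t(2) le_cls_iff[OF XF t(1)]
    proof (intro allI impI)
      fix D f g assume c: "cocone A B D f g"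
      have sub: "(\<lambda>x. trm_eval D f g (F x)) ` X \<subseteq> carrier D" using eval_closed[OF c] F by blast
      have "trm_eval D f g (F x) \<sqsubseteq>\<^bsub>D\<^esub> trm_eval D f g t" if "x \<in> X" for x
        using ub that t c le_cls_iff[OF F[OF that] t(1)] by blast
      then show "trm_eval D f g (Join X F) \<sqsubseteq>\<^bsub>D\<^esub> trm_eval D f g t"
        using eval_Join_is_lub[OF c XF] eval_closed[OF c t(1)] by (simp only: is_lub_iff[OF sub]) blast
    qed
  qed
qed

lemma sup_cls: "wf_trm A B (Join X F) \<Longrightarrow> \<Squnion>\<^bsub>coprod\<^esub> ((\<lambda>x. cls (F x)) ` X) = cls (Join X F)"
  by (rule partial_order.sup_eqI[OF partial_order_coprod is_lub_cls_Join])

lemma wf_Join_rep: "\<lbrakk>X \<subseteq> carrier coprod; small X\<rbrakk> \<Longrightarrow> wf_trm A B (Join X rep)"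
  using rep_wf by auto

lemma cls_rep_image: "X \<subseteq> carrier coprod \<Longrightarrow> (\<lambda>x. cls (rep x)) ` X = X"
  using cls_rep by (auto simp: subset_iff image_iff)

text \<open>Separativity does not transfer one interpretation at a time, because the hypothesis
  tests classes of terms only. The test element is the meet of \<open>s\<close> with the complement
  of \<open>t\<close>: if its class is zero, it evaluates to zero in every \<open>D\<close>, and
  separativity of \<open>D\<close> applies.\<close>

lemma separative_coprod:
  assumes s: "wf_trm A B s" and t: "wf_trm A B t"
    and *: "\<And>w v. \<lbrakk>w \<in> carrier coprod; v \<in> carrier coprod; w \<sqsubseteq>\<^bsub>coprod\<^esub> cls s;
      w \<sqsubseteq>\<^bsub>coprod\<^esub> cls (Cmpl t)\<rbrakk> \<Longrightarrow> w \<sqsubseteq>\<^bsub>coprod\<^esub> v"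
  shows "cls s \<sqsubseteq>\<^bsub>coprod\<^esub> cls t"
proof -
  define X where "X = {cls (Cmpl s), cls t}"
  \<comment> \<open>The De Morgan form of the meet of \<open>s\<close> and \<open>Cmpl t\<close>, as
    terms have no meets.\<close>
  define m where "m = Cmpl (Join X rep)"
  \<comment> \<open>The empty join denotes bottom; the family \<open>LGen\<close> is a
    dummy.\<close>
  define bt :: "'u trm" where "bt = Join {} LGen"
  have X: "X \<subseteq> carrier coprod" "small X"
    unfolding X_def using s t cls_closed by (auto intro: finite_imp_small[OF infinite_UNIV])
  have m: "wf_trm A B m" unfolding m_def using wf_Join_rep[OF X] by simp
  have bt: "wf_trm A B bt" unfolding bt_def by (simp add: finite_imp_small[OF infinite_UNIV])
  have ev: "trm_eval D f g m = complement D (\<Squnion>\<^bsub>D\<^esub> {complement D (trm_eval D f g s), trm_eval D f g t})"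
    if "cocone A B D f g" for D f g
    unfolding m_def X_def using that s t eval_rep_cls[OF that, of "Cmpl s"] eval_rep_cls[OF that, of t]
    by simp
  have glb: "trm_eval D f g m \<sqsubseteq>\<^bsub>D\<^esub> trm_eval D f g s \<and> trm_eval D f g m \<sqsubseteq>\<^bsub>D\<^esub> complement D (trm_eval D f g t) \<and>
     (\<forall>u\<in>carrier D. u \<sqsubseteq>\<^bsub>D\<^esub> trm_eval D f g s \<longrightarrow> u \<sqsubseteq>\<^bsub>D\<^esub> complement D (trm_eval D f g t) \<longrightarrow> u \<sqsubseteq>\<^bsub>D\<^esub> trm_eval D f g m)"
    if c: "cocone A B D f g" for D f g
  proof -
    interpret D: complemented_order D "complement D" by (rule cocone_complemented[OF c])
    note cl = eval_closed[OF c s] eval_closed[OF c t]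
    let ?P = "{trm_eval D f g s, complement D (trm_eval D f g t)}"
    have P: "?P \<subseteq> carrier D" using cl D.N_closed by simp
    have "trm_eval D f g m = \<Sqinter>\<^bsub>D\<^esub> ?P"
      using D.inf_eq_N_sup[OF P D.small_pair] ev[OF c] cl by (simp add: D.N_N)
    then show ?thesis
      using D.is_glb_inf[OF P D.small_pair] unfolding is_glb_iff[OF P] by simp
  qed
  have "cls m \<sqsubseteq>\<^bsub>coprod\<^esub> cls bt"
  proof (rule *)
    show "cls m \<sqsubseteq>\<^bsub>coprod\<^esub> cls s" "cls m \<sqsubseteq>\<^bsub>coprod\<^esub> cls (Cmpl t)"
      using glb s t m by (simp_all add: le_cls_iff)
  qed (use m bt cls_closed in auto)
  then have mb: "trm_eval D f g m \<sqsubseteq>\<^bsub>D\<^esub> trm_eval D f g bt" if "cocone A B D f g" for D f g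
    using le_cls_iff[OF m bt] that by blast
  show ?thesis
    unfolding le_cls_iff[OF s t]
  proof (intro allI impI)
    fix D f g assume c: "cocone A B D f g"
    interpret D: complemented_order D "complement D" by (rule cocone_complemented[OF c])
    show "trm_eval D f g s \<sqsubseteq>\<^bsub>D\<^esub> trm_eval D f g t"
    proof (rule D.separative)
      fix w v assume w: "w \<in> carrier D" "v \<in> carrier D" "w \<sqsubseteq>\<^bsub>D\<^esub> trm_eval D f g s"
        "w \<sqsubseteq>\<^bsub>D\<^esub> complement D (trm_eval D f g t)"
      then have wm: "w \<sqsubseteq>\<^bsub>D\<^esub> trm_eval D f g m" using glb[OF c] by blast
      have "trm_eval D f g bt \<sqsubseteq>\<^bsub>D\<^esub> v"
        unfolding bt_def using D.is_lub_sup[of "{}"] D.small_empty w(2) by (simp add: least_def)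
      then show "w \<sqsubseteq>\<^bsub>D\<^esub> v"
        using D.le_trans[OF wm mb[OF c]] D.le_trans[of w "trm_eval D f g bt" v] w
          eval_closed[OF c m] eval_closed[OF c bt] by simp
    qed (use eval_closed[OF c] s t in auto)
  qed
qed

sublocale coprod: complemented_order coprod cpl
proof -
  interpret partial_order coprod by (rule partial_order_coprod)
  show "complemented_order coprod cpl"
  proof
    show "infinite (UNIV :: 'u set)" by (rule infinite_UNIV)
  next
    fix x assume "x \<in> carrier coprod"
    then obtain t where t: "wf_trm A B t" "x = cls t" by (rule coprod_cases)
    show "cpl x \<in> carrier coprod" using t by (simp add: cpl_cls cls_closed)
    have "trm_equiv A B (Cmpl (Cmpl t)) t"
      unfolding trm_equiv_def
      using complemented_order.N_N[OF cocone_complemented] eval_closed t by simp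
    then show "cpl (cpl x) = x" using t by (simp add: cpl_cls cls_eq_iff)
  next
    fix x y assume xy: "x \<in> carrier coprod" "y \<in> carrier coprod" "x \<sqsubseteq>\<^bsub>coprod\<^esub> y"
    obtain s where s: "wf_trm A B s" "x = cls s" using xy(1) by (rule coprod_cases)
    obtain t where t: "wf_trm A B t" "y = cls t" using xy(2) by (rule coprod_cases)
    show "cpl y \<sqsubseteq>\<^bsub>coprod\<^esub> cpl x"
      using xy(3) s t complemented_order.N_antimono[OF cocone_complemented] eval_closed
      by (simp add: cpl_cls le_cls_iff)
  next
    fix x y z assume xyz: "x \<in> carrier coprod" "y \<in> carrier coprod" "z \<in> carrier coprod"
      "z \<sqsubseteq>\<^bsub>coprod\<^esub> x" "z \<sqsubseteq>\<^bsub>coprod\<^esub> cpl x"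
    obtain s where s: "wf_trm A B s" "x = cls s" using xyz(1) by (rule coprod_cases)
    obtain t where t: "wf_trm A B t" "y = cls t" using xyz(2) by (rule coprod_cases)
    obtain u where u: "wf_trm A B u" "z = cls u" using xyz(3) by (rule coprod_cases)
    show "z \<sqsubseteq>\<^bsub>coprod\<^esub> y"
      unfolding u(2) t(2) le_cls_iff[OF u(1) t(1)]
    proof (intro allI impI)
      fix D f g assume c: "cocone A B D f g"
      have "trm_eval D f g u \<sqsubseteq>\<^bsub>D\<^esub> trm_eval D f g s" "trm_eval D f g u \<sqsubseteq>\<^bsub>D\<^esub> complement D (trm_eval D f g s)"
        using xyz(4,5) c s u by (simp_all add: cpl_cls le_cls_iff)
      then show "trm_eval D f g u \<sqsubseteq>\<^bsub>D\<^esub> trm_eval D f g t"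
        by (intro complemented_order.N_disjoint[OF cocone_complemented[OF c],
              of "trm_eval D f g s" "trm_eval D f g t" "trm_eval D f g u"])
          (use eval_closed[OF c] s t u in simp_all)
    qed
  next
    fix x y assume xy: "x \<in> carrier coprod" "y \<in> carrier coprod"
      and *: "\<And>w v. \<lbrakk>w \<in> carrier coprod; v \<in> carrier coprod; w \<sqsubseteq>\<^bsub>coprod\<^esub> x;
        w \<sqsubseteq>\<^bsub>coprod\<^esub> cpl y\<rbrakk> \<Longrightarrow> w \<sqsubseteq>\<^bsub>coprod\<^esub> v"
    obtain s where s: "wf_trm A B s" "x = cls s" using xy(1) by (rule coprod_cases)
    obtain t where t: "wf_trm A B t" "y = cls t" using xy(2) by (rule coprod_cases)
    show "x \<sqsubseteq>\<^bsub>coprod\<^esub> y"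
      using separative_coprod[OF s(1) t(1)] * unfolding s(2) t(2) cpl_cls[OF t(1)] .
  next
    fix X assume X: "X \<subseteq> carrier coprod" "small X"
    show "\<exists>s. is_lub coprod s X"
      using is_lub_cls_Join[OF wf_Join_rep[OF X]] unfolding cls_rep_image[OF X(1)] by blast
  qed
qed

lemma LGen_hom: "(\<lambda>x. cls (LGen x)) \<in> complete_boolean_hom A coprod"
proof (rule complete_boolean_homI)
  show A': "complemented_order A (complement A)"
    by (rule complete_boolean_lattice_imp_complemented_order[OF infinite_UNIV A])
  interpret A: complemented_order A "complement A" by fact
  show "complemented_order coprod cpl" ..
  show "(\<lambda>x. cls (LGen x)) \<in> carrier A \<rightarrow> carrier coprod" by (simp add: cls_closed)
  show "cls (LGen (complement A x)) = cpl (cls (LGen x))" if x: "x \<in> carrier A" for x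
  proof -
    have "trm_equiv A B (LGen (complement A x)) (Cmpl (LGen x))"
      unfolding trm_equiv_def
      using complete_boolean_hom_complement[OF A' cocone_complemented _ x]
      by (auto simp: cocone_def)
    then show ?thesis using x A.N_closed by (simp add: cpl_cls cls_eq_iff)
  qed
  show "cls (LGen (\<Squnion>\<^bsub>A\<^esub> S)) = \<Squnion>\<^bsub>coprod\<^esub> ((\<lambda>x. cls (LGen x)) ` S)"
    if S: "S \<subseteq> carrier A" "small S" for S
  proof -
    have wf: "wf_trm A B (Join S LGen)" using S by auto
    have "trm_equiv A B (LGen (\<Squnion>\<^bsub>A\<^esub> S)) (Join S LGen)"
      unfolding trm_equiv_def cocone_def complete_boolean_hom_def using S by simp
    then show ?thesis using wf A.is_lub_sup[OF S] by (simp add: sup_cls cls_eq_iff)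
  qed
qed

lemma RGen_hom: "(\<lambda>x. cls (RGen x)) \<in> complete_boolean_hom B coprod"
proof (rule complete_boolean_homI)
  show B': "complemented_order B (complement B)"
    by (rule complete_boolean_lattice_imp_complemented_order[OF infinite_UNIV B])
  interpret B: complemented_order B "complement B" by fact
  show "complemented_order coprod cpl" ..
  show "(\<lambda>x. cls (RGen x)) \<in> carrier B \<rightarrow> carrier coprod" by (simp add: cls_closed)
  show "cls (RGen (complement B x)) = cpl (cls (RGen x))" if x: "x \<in> carrier B" for x
  proof -
    have "trm_equiv A B (RGen (complement B x)) (Cmpl (RGen x))"
      unfolding trm_equiv_def
      using complete_boolean_hom_complement[OF B' cocone_complemented _ x]
      by (auto simp: cocone_def)
    then show ?thesis using x B.N_closed by (simp add: cpl_cls cls_eq_iff)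
  qed
  show "cls (RGen (\<Squnion>\<^bsub>B\<^esub> S)) = \<Squnion>\<^bsub>coprod\<^esub> ((\<lambda>x. cls (RGen x)) ` S)"
    if S: "S \<subseteq> carrier B" "small S" for S
  proof -
    have wf: "wf_trm A B (Join S RGen)" using S by auto
    have "trm_equiv A B (RGen (\<Squnion>\<^bsub>B\<^esub> S)) (Join S RGen)"
      unfolding trm_equiv_def cocone_def complete_boolean_hom_def using S by simp
    then show ?thesis using wf B.is_lub_sup[OF S] by (simp add: sup_cls cls_eq_iff)
  qed
qed

lemma mediating_hom:
  assumes c: "cocone A B D f g"
  shows "(\<lambda>x. trm_eval D f g (rep x)) \<in> complete_boolean_hom coprod D"
proof (rule complete_boolean_homI)
  show "complemented_order coprod cpl" ..
  show "complemented_order D (complement D)" by (rule cocone_complemented[OF c])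
  show "(\<lambda>x. trm_eval D f g (rep x)) \<in> carrier coprod \<rightarrow> carrier D"
    using eval_closed[OF c] rep_wf by blast
  show "trm_eval D f g (rep (cpl x)) = complement D (trm_eval D f g (rep x))" if "x \<in> carrier coprod" for x
    unfolding cpl_def using eval_rep_cls[OF c, of "Cmpl (rep x)"] rep_wf[OF that] by simp
  show "trm_eval D f g (rep (\<Squnion>\<^bsub>coprod\<^esub> X)) = \<Squnion>\<^bsub>D\<^esub> ((\<lambda>x. trm_eval D f g (rep x)) ` X)"
    if X: "X \<subseteq> carrier coprod" "small X" for X
    using sup_cls[OF wf_Join_rep[OF X]] eval_rep_cls[OF c wf_Join_rep[OF X]]
    unfolding cls_rep_image[OF X(1)] by simp
qed

text \<open>Uniqueness of the mediating map: every class is built from generators by complements and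
  small joins, which \<open>h\<close> preserves.\<close>

lemma hom_eq_eval:
  assumes c: "cocone A B D f g" and h: "h \<in> complete_boolean_hom coprod D"
    and hf: "\<forall>x\<in>carrier A. h (cls (LGen x)) = f x" and hg: "\<forall>x\<in>carrier B. h (cls (RGen x)) = g x"
  shows "wf_trm A B t \<Longrightarrow> h (cls t) = trm_eval D f g t"
proof (induction t)
  case (Cmpl t)
  then show ?case
    using complete_boolean_hom_complement[OF coprod.complemented_order_axioms
        cocone_complemented[OF c] h cls_closed[of t]]
    by (simp add: cpl_cls)
next
  case (Join X F)
  have sub: "(\<lambda>x. cls (F x)) ` X \<subseteq> carrier coprod" "small ((\<lambda>x. cls (F x)) ` X)"
    using Join.prems cls_closed by (auto intro: small_image)
  have "h (cls (Join X F)) = h (\<Squnion>\<^bsub>coprod\<^esub> ((\<lambda>x. cls (F x)) ` X))"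
    using sup_cls[OF Join.prems] by simp
  also have "\<dots> = \<Squnion>\<^bsub>D\<^esub> (h ` (\<lambda>x. cls (F x)) ` X)"
    using h sub unfolding complete_boolean_hom_def by blast
  also have "h ` (\<lambda>x. cls (F x)) ` X = (\<lambda>x. trm_eval D f g (F x)) ` X"
    unfolding image_image using Join by (intro image_cong) auto
  finally show ?case by simp
qed (use hf hg in auto)

lemma is_coproduct_coprod:
  "is_coproduct A B coprod (\<lambda>x. cls (LGen x)) (\<lambda>x. cls (RGen x))"
proof -
  have "\<exists>h\<in>complete_boolean_hom coprod D.
      (\<forall>x\<in>carrier A. h (cls (LGen x)) = f x) \<and> (\<forall>x\<in>carrier B. h (cls (RGen x)) = g x) \<and>
      (\<forall>h'\<in>complete_boolean_hom coprod D.
         (\<forall>x\<in>carrier A. h' (cls (LGen x)) = f x) \<and> (\<forall>x\<in>carrier B. h' (cls (RGen x)) = g x) \<longrightarrow>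
         (\<forall>z\<in>carrier coprod. h' z = h z))"
    if c: "cocone A B D f g" for D f g
  proof (intro bexI[OF _ mediating_hom[OF c]] conjI ballI impI)
    fix h' z assume "h' \<in> complete_boolean_hom coprod D" "z \<in> carrier coprod"
      "(\<forall>x\<in>carrier A. h' (cls (LGen x)) = f x) \<and> (\<forall>x\<in>carrier B. h' (cls (RGen x)) = g x)"
    then show "h' z = trm_eval D f g (rep z)"
      using hom_eq_eval[OF c, of h' "rep z"] rep_wf[of z] cls_rep[of z] by simp
  qed (simp_all add: eval_rep_cls[OF c])
  then show ?thesis
    unfolding is_coproduct_def
    using coprod.complete_boolean_lattice_axioms LGen_hom RGen_hom by (simp add: cocone_def)
qed

end

theorem coproduct_exists:
  fixes A B :: "'u gorder"
  assumes u: "set_universe TYPE('u)"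
    and "complete_boolean_lattice A" "complete_boolean_lattice B"
  shows "\<exists>C i j. is_coproduct A B C i j"
proof -
  obtain cls :: "'u trm \<Rightarrow> 'u"
    where "\<forall>s t. wf_trm A B s \<longrightarrow> wf_trm A B t \<longrightarrow> (cls s = cls t \<longleftrightarrow> trm_equiv A B s t)"
    using trm_classes_in_universe[OF u, of A B] by (rule exE)
  then interpret coproduct_terms A B cls
    using assms set_universe_infinite by (intro coproduct_terms.intro) simp_all
  show ?thesis using is_coproduct_coprod by blast
qed

section \<open>Regular open algebras of forcing notions\<close>

locale forcing =
  fixes P :: "'p set" and ext :: "'p \<Rightarrow> 'p \<Rightarrow> bool" (infix \<open>\<preceq>\<close> 50)
  assumes ext_refl: "p \<in> P \<Longrightarrow> p \<preceq> p"
    and ext_trans: "\<lbrakk>p \<in> P; q \<in> P; r \<in> P; p \<preceq> q; q \<preceq> r\<rbrakk> \<Longrightarrow> p \<preceq> r"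
begin

text \<open>The interior of the complement in the topology whose open sets are the downsets; hence
  \<open>neg (neg U)\<close> is the interior of the closure, and \<open>regular\<close> means
  regular open.\<close>

definition neg :: "'p set \<Rightarrow> 'p set"
  where "neg U = {p \<in> P. \<forall>q\<in>P. q \<preceq> p \<longrightarrow> q \<notin> U}"

definition downset :: "'p set \<Rightarrow> bool"
  where "downset U \<longleftrightarrow> U \<subseteq> P \<and> (\<forall>p\<in>U. \<forall>q\<in>P. q \<preceq> p \<longrightarrow> q \<in> U)"

definition regular :: "'p set \<Rightarrow> bool"
  where "regular U \<longleftrightarrow> downset U \<and> neg (neg U) \<subseteq> U"

lemma neg_subset: "neg U \<subseteq> P"
  unfolding neg_def by blast

lemma neg_antimono: "U \<subseteq> V \<Longrightarrow> neg V \<subseteq> neg U"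
  unfolding neg_def by blast

lemma downset_neg: "downset (neg U)"
  unfolding downset_def neg_def using ext_trans by blast

lemma subset_neg_neg: "downset U \<Longrightarrow> U \<subseteq> neg (neg U)"
  unfolding downset_def neg_def using ext_refl by blast

lemma regular_neg: "downset U \<Longrightarrow> regular (neg U)"
  unfolding regular_def using downset_neg neg_antimono[OF subset_neg_neg] by blast

lemma neg_neg: "regular U \<Longrightarrow> neg (neg U) = U"
  unfolding regular_def using subset_neg_neg by blast

lemma regular_downset: "regular U \<Longrightarrow> downset U"
  unfolding regular_def by blast

lemma regular_subset: "regular U \<Longrightarrow> U \<subseteq> P"
  unfolding regular_def downset_def by blast

lemma regular_iff:
  "regular U \<longleftrightarrow> downset U \<and> (\<forall>p\<in>P. (\<forall>q\<in>P. q \<preceq> p \<longrightarrow> (\<exists>r\<in>P. r \<preceq> q \<and> r \<in> U)) \<longrightarrow> p \<in> U)"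
  unfolding regular_def neg_def by blast

text \<open>Intersecting with \<open>P\<close> makes the empty family yield the top element.\<close>

lemma regular_Inter:
  assumes "\<And>U. U \<in> \<U> \<Longrightarrow> regular U"
  shows "regular (P \<inter> \<Inter> \<U>)"
proof -
  have "downset (P \<inter> \<Inter> \<U>)"
    using regular_downset[OF assms] unfolding downset_def by blast
  moreover have "neg (neg (P \<inter> \<Inter> \<U>)) \<subseteq> U" if "U \<in> \<U>" for U
    using neg_antimono[OF neg_antimono, of "P \<inter> \<Inter> \<U>" U] neg_neg[OF assms[OF that]] that by blast
  ultimately show ?thesis
    unfolding regular_def using neg_subset by blast
qed

lemma regular_Int:
  assumes "regular U" "regular V" shows "regular (U \<inter> V)"
proof -
  have "regular (P \<inter> \<Inter> {U, V})" by (rule regular_Inter) (use assms in auto)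
  moreover have "P \<inter> \<Inter> {U, V} = U \<inter> V" using regular_subset[OF assms(1)] by auto
  ultimately show ?thesis by simp
qed

lemma downset_Union: "(\<And>U. U \<in> \<U> \<Longrightarrow> downset U) \<Longrightarrow> downset (\<Union> \<U>)"
  unfolding downset_def by blast

text \<open>A regular set contains every condition below which it is dense, so it is determined by
  its trace on a dense set. Later \<Delta> consists of the conditions long enough to decide the
  statement at hand.\<close>

lemma regular_eqI:
  assumes U: "regular U" and V: "regular V"
    and dense: "\<And>p. p \<in> P \<Longrightarrow> \<exists>q\<in>P. q \<preceq> p \<and> q \<in> \<Delta>"
    and agree: "\<And>p. \<lbrakk>p \<in> P; p \<in> \<Delta>\<rbrakk> \<Longrightarrow> p \<in> U \<longleftrightarrow> p \<in> V"
  shows "U = V"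
proof -
  have "X \<subseteq> Z" if X: "regular X" and Z: "regular Z"
    and eq: "\<And>p. \<lbrakk>p \<in> P; p \<in> \<Delta>\<rbrakk> \<Longrightarrow> p \<in> X \<longleftrightarrow> p \<in> Z" for X Z
  proof
    fix p assume p: "p \<in> X"
    have "\<exists>r\<in>P. r \<preceq> q \<and> r \<in> Z" if q: "q \<in> P" "q \<preceq> p" for q
    proof -
      have qX: "q \<in> X" using regular_downset[OF X] p q unfolding downset_def by blast
      obtain r where r: "r \<in> P" "r \<preceq> q" "r \<in> \<Delta>" using dense[OF q(1)] by blast
      then have "r \<in> X" using regular_downset[OF X] qX unfolding downset_def by blast
      then show ?thesis using r eq by blast
    qed
    then show "p \<in> Z" using Z p regular_subset[OF X] unfolding regular_iff by blast
  qed
  from this[OF U V] this[OF V U] agree show ?thesis by blast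
qed

end

locale regular_algebra = forcing P ext for P :: "'p set" and ext (infix \<open>\<preceq>\<close> 50) +
  fixes code :: "'p set \<Rightarrow> 'u"
  assumes infinite_UNIV: "infinite (UNIV :: 'u set)"
    and inj_code: "inj_on code (Pow P)"
begin

definition decode :: "'u \<Rightarrow> 'p set"
  where "decode = the_inv_into (Pow P) code"

definition RO :: "'u gorder"
  where "RO = \<lparr>carrier = code ` {U. regular U}, eq = (=), le = (\<lambda>x y. decode x \<subseteq> decode y)\<rparr>"

definition cpl :: "'u \<Rightarrow> 'u"
  where "cpl x = code (neg (decode x))"

lemma decode_code: "U \<subseteq> P \<Longrightarrow> decode (code U) = U"
  unfolding decode_def by (simp add: the_inv_into_f_f[OF inj_code])

lemma carrier_RO: "x \<in> carrier RO \<longleftrightarrow> (\<exists>U. regular U \<and> x = code U)"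
  unfolding RO_def by auto

lemma le_RO: "x \<sqsubseteq>\<^bsub>RO\<^esub> y \<longleftrightarrow> decode x \<subseteq> decode y"
  unfolding RO_def by simp

lemma code_closed: "regular U \<Longrightarrow> code U \<in> carrier RO"
  using carrier_RO by blast

lemma decode_regular: "x \<in> carrier RO \<Longrightarrow> regular (decode x)"
  and code_decode: "x \<in> carrier RO \<Longrightarrow> code (decode x) = x"
  using carrier_RO decode_code[OF regular_subset] by auto

lemma RO_eqI: "\<lbrakk>x \<in> carrier RO; y \<in> carrier RO; decode x = decode y\<rbrakk> \<Longrightarrow> x = y"
  using code_decode by metis

lemma decode_cpl: "decode (cpl x) = neg (decode x)"
  unfolding cpl_def by (rule decode_code[OF neg_subset])

lemma cpl_closed: "x \<in> carrier RO \<Longrightarrow> cpl x \<in> carrier RO"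
  unfolding cpl_def by (intro code_closed regular_neg regular_downset decode_regular)

lemma partial_order_RO: "partial_order RO"
proof
  show "(.=\<^bsub>RO\<^esub>) = (=)" by (simp add: RO_def)
  fix x y assume "x \<sqsubseteq>\<^bsub>RO\<^esub> y" "y \<sqsubseteq>\<^bsub>RO\<^esub> x" "x \<in> carrier RO" "y \<in> carrier RO"
  then have "x = y" using RO_eqI le_RO by blast
  then show "x .=\<^bsub>RO\<^esub> y" by (simp add: RO_def)
qed (auto simp: RO_def)

lemma is_lub_RO:
  assumes A: "A \<subseteq> carrier RO"
  shows "is_lub RO (code (neg (neg (\<Union> (decode ` A))))) A"
  unfolding is_lub_iff[OF A]
proof (intro conjI ballI impI)
  let ?s = "neg (neg (\<Union> (decode ` A)))"
  show "code ?s \<in> carrier RO" by (intro code_closed regular_neg downset_neg)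
  have "downset (\<Union> (decode ` A))"
    using A decode_regular regular_downset by (intro downset_Union) blast
  note sub = subset_neg_neg[OF this]
  fix a assume "a \<in> A"
  then show "a \<sqsubseteq>\<^bsub>RO\<^esub> code ?s" unfolding le_RO decode_code[OF neg_subset] using sub by blast
next
  fix v assume v: "v \<in> carrier RO" "\<forall>a\<in>A. a \<sqsubseteq>\<^bsub>RO\<^esub> v"
  then have "\<Union> (decode ` A) \<subseteq> decode v" unfolding le_RO by blast
  from neg_antimono[OF neg_antimono[OF this]]
  show "code (neg (neg (\<Union> (decode ` A)))) \<sqsubseteq>\<^bsub>RO\<^esub> v"
    unfolding le_RO decode_code[OF neg_subset] using neg_neg[OF decode_regular[OF v(1)]] by simp
qed

lemma is_glb_RO:
  assumes A: "A \<subseteq> carrier RO"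
  shows "is_glb RO (code (P \<inter> \<Inter> (decode ` A))) A"
proof -
  have dec: "decode (code (P \<inter> \<Inter> (decode ` A))) = P \<inter> \<Inter> (decode ` A)"
    by (rule decode_code) blast
  have "regular (P \<inter> \<Inter> (decode ` A))"
    using A decode_regular by (intro regular_Inter) blast
  then show ?thesis
    unfolding is_glb_iff[OF A] le_RO dec
    using code_closed regular_subset[OF decode_regular] by blast
qed

sublocale RO: complemented_order RO cpl
proof -
  interpret partial_order RO by (rule partial_order_RO)
  show "complemented_order RO cpl"
  proof
    show "infinite (UNIV :: 'u set)" by (rule infinite_UNIV)
  next
    fix x assume x: "x \<in> carrier RO"
    show "cpl x \<in> carrier RO" by (rule cpl_closed[OF x])
    show "cpl (cpl x) = x"
      by (rule RO_eqI)
        (use x cpl_closed in \<open>simp_all add: decode_cpl neg_neg decode_regular\<close>)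
  next
    fix x y assume "x \<sqsubseteq>\<^bsub>RO\<^esub> y"
    then show "cpl y \<sqsubseteq>\<^bsub>RO\<^esub> cpl x" unfolding le_RO decode_cpl by (rule neg_antimono)
  next
    fix x y z assume "z \<in> carrier RO" "z \<sqsubseteq>\<^bsub>RO\<^esub> x" "z \<sqsubseteq>\<^bsub>RO\<^esub> cpl x"
    then have "decode z = {}"
      unfolding le_RO decode_cpl neg_def using ext_refl by blast
    then show "z \<sqsubseteq>\<^bsub>RO\<^esub> y" unfolding le_RO by simp
  next
    fix x y assume x: "x \<in> carrier RO" and y: "y \<in> carrier RO"
      and *: "\<And>w v. \<lbrakk>w \<in> carrier RO; v \<in> carrier RO; w \<sqsubseteq>\<^bsub>RO\<^esub> x; w \<sqsubseteq>\<^bsub>RO\<^esub> cpl y\<rbrakk> \<Longrightarrow> w \<sqsubseteq>\<^bsub>RO\<^esub> v"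
    \<comment> \<open>The part of \<open>x\<close> that refutes \<open>y\<close>; it has to be zero,
      and then \<open>y\<close> is dense below every condition in \<open>x\<close>.\<close>
    let ?W = "decode x \<inter> neg (decode y)"
    have W: "regular ?W"
      using x y by (intro regular_Int regular_neg regular_downset decode_regular)
    have bot: "regular {}" unfolding regular_def downset_def neg_def using ext_refl by blast
    have "code ?W \<sqsubseteq>\<^bsub>RO\<^esub> code {}"
      by (rule *) (use W bot in \<open>auto simp: code_closed le_RO decode_cpl decode_code regular_subset\<close>)
    then have "?W = {}"
      unfolding le_RO decode_code[OF regular_subset[OF W]] decode_code[OF empty_subsetI] by simp
    then have "decode x \<subseteq> neg (neg (decode y))"
      using regular_downset[OF decode_regular[OF x]] unfolding downset_def neg_def[of "neg _"] by blast
    then show "x \<sqsubseteq>\<^bsub>RO\<^esub> y" unfolding le_RO neg_neg[OF decode_regular[OF y]] .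
  next
    fix A assume "A \<subseteq> carrier RO"
    then show "\<exists>s. is_lub RO s A" using is_lub_RO by blast
  qed
qed

lemma sup_RO: "A \<subseteq> carrier RO \<Longrightarrow> \<Squnion>\<^bsub>RO\<^esub> A = code (neg (neg (\<Union> (decode ` A))))"
  by (rule RO.sup_eqI[OF is_lub_RO])

lemma decode_inf: "A \<subseteq> carrier RO \<Longrightarrow> decode (\<Sqinter>\<^bsub>RO\<^esub> A) = P \<inter> \<Inter> (decode ` A)"
  using RO.inf_eqI[OF is_glb_RO] decode_code[of "P \<inter> _"] by simp

end

section \<open>Projections of forcing notions and their pullback homomorphisms\<close>

text \<open>\<open>proj_lift\<close> is the combinatorial form of genericity of the projected
  object: every extension of \<pi> \<open>p\<close> in \<open>Q\<close> is refined by the projection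
  of some extension of \<open>p\<close>.\<close>

locale forcing_projection =
  P: forcing P extP + Q: forcing Q extQ for P :: "'p set" and extP and Q :: "'q set" and extQ +
  fixes \<pi> :: "'p \<Rightarrow> 'q"
  assumes proj_closed: "p \<in> P \<Longrightarrow> \<pi> p \<in> Q"
    and proj_mono: "\<lbrakk>p \<in> P; p' \<in> P; extP p' p\<rbrakk> \<Longrightarrow> extQ (\<pi> p') (\<pi> p)"
    and proj_lift: "\<lbrakk>p \<in> P; q \<in> Q; extQ q (\<pi> p)\<rbrakk> \<Longrightarrow> \<exists>p'\<in>P. extP p' p \<and> extQ (\<pi> p') q"
begin

definition pre :: "'q set \<Rightarrow> 'p set"
  where "pre U = {p \<in> P. \<pi> p \<in> U}"

lemma downset_pre: "Q.downset U \<Longrightarrow> P.downset (pre U)"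
  unfolding Q.downset_def P.downset_def pre_def using proj_closed proj_mono by blast

text \<open>Monotonicity gives one inclusion. For the other, an extension of \<pi> \<open>p\<close>
  in \<open>U\<close> lifts to an extension of \<open>p\<close> whose projection is still in the
  downset \<open>U\<close>.\<close>

lemma pre_neg:
  assumes U: "Q.downset U"
  shows "pre (Q.neg U) = P.neg (pre U)"
proof (intro equalityI subsetI)
  fix p assume "p \<in> pre (Q.neg U)"
  then show "p \<in> P.neg (pre U)"
    unfolding pre_def Q.neg_def P.neg_def using proj_closed proj_mono by blast
next
  fix p assume p: "p \<in> P.neg (pre U)"
  then have pP: "p \<in> P" unfolding P.neg_def by blast
  have "q \<notin> U" if q: "q \<in> Q" "extQ q (\<pi> p)" for q
  proof
    assume "q \<in> U"
    obtain p' where p': "p' \<in> P" "extP p' p" "extQ (\<pi> p') q" using proj_lift[OF pP q] by blast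
    then have "\<pi> p' \<in> U" using U \<open>q \<in> U\<close> proj_closed unfolding Q.downset_def by blast
    then show False using p p' unfolding P.neg_def pre_def by blast
  qed
  then show "p \<in> pre (Q.neg U)" unfolding pre_def Q.neg_def using pP proj_closed by blast
qed

lemma regular_pre: "Q.regular U \<Longrightarrow> P.regular (pre U)"
  using pre_neg[OF Q.downset_neg, of U] pre_neg[OF Q.regular_downset, of U] downset_pre
    Q.neg_neg[of U] unfolding P.regular_def by (auto simp: Q.regular_downset)

end

locale regular_algebra_projection =
  forcing_projection P extP Q extQ \<pi> + P: regular_algebra P extP codeP + Q: regular_algebra Q extQ codeQ
  for P :: "'p set" and extP and Q :: "'q set" and extQ \<pi>
    and codeP :: "'p set \<Rightarrow> 'u" and codeQ :: "'q set \<Rightarrow> 'u"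
begin

definition pullback :: "'u \<Rightarrow> 'u"
  where "pullback x = codeP (pre (Q.decode x))"

lemma decode_pullback: "P.decode (pullback x) = pre (Q.decode x)"
  unfolding pullback_def by (rule P.decode_code) (auto simp: pre_def)

lemma pullback_closed: "x \<in> carrier Q.RO \<Longrightarrow> pullback x \<in> carrier P.RO"
  unfolding pullback_def by (intro P.code_closed regular_pre Q.decode_regular)

text \<open>Suprema are double negations of unions, and preimages commute with \<open>neg\<close>
  and with unions.\<close>

lemma pullback_hom: "pullback \<in> complete_boolean_hom Q.RO P.RO"
proof (rule complete_boolean_homI)
  show "complemented_order Q.RO Q.cpl" "complemented_order P.RO P.cpl" by unfold_locales
  show "pullback \<in> carrier Q.RO \<rightarrow> carrier P.RO" using pullback_closed by blast
  show "pullback (Q.cpl x) = P.cpl (pullback x)" if x: "x \<in> carrier Q.RO" for x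
    unfolding pullback_def[of "Q.cpl x"] P.cpl_def decode_pullback Q.decode_cpl
    using pre_neg[OF Q.regular_downset[OF Q.decode_regular[OF x]]] by simp
  show "pullback (\<Squnion>\<^bsub>Q.RO\<^esub> A) = \<Squnion>\<^bsub>P.RO\<^esub> (pullback ` A)" if A: "A \<subseteq> carrier Q.RO" for A
  proof -
    have im: "pullback ` A \<subseteq> carrier P.RO" using A pullback_closed by blast
    have d: "Q.downset (\<Union> (Q.decode ` A))"
      using A Q.decode_regular Q.regular_downset by (intro Q.downset_Union) blast
    have "pre (\<Union> (Q.decode ` A)) = \<Union> (P.decode ` pullback ` A)"
      unfolding image_image decode_pullback unfolding pre_def by blast
    then show ?thesis
      unfolding Q.sup_RO[OF A] P.sup_RO[OF im]
      unfolding pullback_def Q.decode_code[OF Q.neg_subset] pre_neg[OF Q.downset_neg] pre_neg[OF d]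
      by simp
  qed
qed

end

section \<open>The Cohen algebra and collapsing conditions\<close>

text \<open>
  A condition carries total functions of which only the entries with indices below its length
  matter; the orders are therefore merely preorders.
\<close>

type_synonym matrix_cond = "nat \<times> (nat \<Rightarrow> nat \<Rightarrow> bool)"
type_synonym 'u seq_cond = "nat \<times> (nat \<Rightarrow> 'u) \<times> (nat \<Rightarrow> nat \<Rightarrow> bool)"

definition matrix_ext :: "matrix_cond \<Rightarrow> matrix_cond \<Rightarrow> bool"
  where "matrix_ext = (\<lambda>(k', M') (k, M). k \<le> k' \<and> (\<forall>i<k. \<forall>j<k. M' i j = M i j))"

definition seq_conds :: "'u set \<Rightarrow> 'u seq_cond set"
  where "seq_conds Y = UNIV \<times> {s. range s \<subseteq> Y} \<times> UNIV"

definition seq_ext :: "'u seq_cond \<Rightarrow> 'u seq_cond \<Rightarrow> bool"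
  where "seq_ext = (\<lambda>(k', s', M') (k, s, M).
    k \<le> k' \<and> (\<forall>i<k. s' i = s i) \<and> (\<forall>i<k. \<forall>j<k. M' i j = M i j))"

lemma matrix_ext_iff:
  "matrix_ext (k', M') (k, M) \<longleftrightarrow> k \<le> k' \<and> (\<forall>i<k. \<forall>j<k. M' i j = M i j)"
  by (simp add: matrix_ext_def)

lemma seq_ext_iff:
  "seq_ext (k', s', M') (k, s, M) \<longleftrightarrow>
    k \<le> k' \<and> (\<forall>i<k. s' i = s i) \<and> (\<forall>i<k. \<forall>j<k. M' i j = M i j)"
  by (simp add: seq_ext_def)

definition plain :: "'u seq_cond \<Rightarrow> matrix_cond"
  where "plain = (\<lambda>(k, s, M). (k, M))"

definition twisted :: "('u \<times> 'u) set \<Rightarrow> 'u seq_cond \<Rightarrow> matrix_cond"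
  where "twisted lt = (\<lambda>(k, s, M). (k, \<lambda>i j. M i j \<noteq> ((s i, s j) \<in> lt)))"

interpretation matrix: forcing UNIV matrix_ext
  by unfold_locales (auto simp: matrix_ext_iff)

interpretation seq: forcing "seq_conds Y" seq_ext for Y
  by unfold_locales (auto simp: seq_ext_iff)

lemma plain_projection: "forcing_projection (seq_conds Y) seq_ext UNIV matrix_ext plain"
proof
  fix p q assume "p \<in> seq_conds Y" and ext: "matrix_ext q (plain p)"
  obtain k s M where p: "p = (k, s, M)" by (cases p)
  obtain k' M' where q: "q = (k', M')" by (cases q)
  \<comment> \<open>The lift keeps \<open>s\<close>: being total, it already supplies entries in
    \<open>Y\<close> up to the new length.\<close>
  have "(k', s, M') \<in> seq_conds Y" "seq_ext (k', s, M') p" "matrix_ext (plain (k', s, M')) q"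
    using \<open>p \<in> _\<close> ext by (auto simp: p q seq_conds_def seq_ext_iff matrix_ext_iff plain_def)
  then show "\<exists>p'\<in>seq_conds Y. seq_ext p' p \<and> matrix_ext (plain p') q" by blast
qed (auto simp: seq_ext_iff matrix_ext_iff plain_def)

lemma twisted_projection: "forcing_projection (seq_conds Y) seq_ext UNIV matrix_ext (twisted lt)"
proof
  fix p q assume "p \<in> seq_conds Y" and ext: "matrix_ext q (twisted lt p)"
  obtain k s M where p: "p = (k, s, M)" by (cases p)
  obtain k' M' where q: "q = (k', M')" by (cases q)
  \<comment> \<open>Exclusive or with the order is an involution, so twisting \<open>M'\<close>
    yields a matrix whose own twist is \<open>M'\<close> again.\<close>
  let ?p' = "(k', s, \<lambda>i j. M' i j \<noteq> ((s i, s j) \<in> lt))"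
  have "?p' \<in> seq_conds Y" "seq_ext ?p' p" "matrix_ext (twisted lt ?p') q"
    using \<open>p \<in> _\<close> ext by (auto simp: p q seq_conds_def seq_ext_iff matrix_ext_iff twisted_def)
  then show "\<exists>p'\<in>seq_conds Y. seq_ext p' p \<and> matrix_ext (twisted lt p') q" by blast
qed (auto simp: seq_ext_iff matrix_ext_iff twisted_def)

text \<open>The Boolean value of "entry \<open>i j\<close> of the generic matrix is true", written
  as the negation of its refutations so that regularity is an instance of
  \<open>regular_neg\<close>.\<close>

definition entry :: "nat \<Rightarrow> nat \<Rightarrow> matrix_cond set"
  where "entry i j = matrix.neg {(k, M). i < k \<and> j < k \<and> \<not> M i j}"

lemma regular_entry: "matrix.regular (entry i j)"
  unfolding entry_def
  by (rule matrix.regular_neg) (auto simp: matrix.downset_def matrix_ext_iff)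

lemma mem_entry: "\<lbrakk>i < k; j < k\<rbrakk> \<Longrightarrow> (k, M) \<in> entry i j \<longleftrightarrow> M i j"
  by (auto simp: entry_def matrix.neg_def matrix_ext_iff)

section \<open>Recovering the generic sequence from the two matrices\<close>

text \<open>\<open>S\<close> abstracts the image of a small coproduct: a complete subalgebra of the
  regular sets containing the entries of both matrices.\<close>

locale generated_family =
  fixes Y :: "'u set" and lt :: "('u \<times> 'u) set" and S :: "'u seq_cond set set"
  assumes wf_lt: "wf lt"
    and total_lt: "\<lbrakk>x \<in> Y; y \<in> Y; x \<noteq> y\<rbrakk> \<Longrightarrow> (x, y) \<in> lt \<or> (y, x) \<in> lt"
    and S_regular: "U \<in> S \<Longrightarrow> seq.regular Y U"
    and S_neg: "U \<in> S \<Longrightarrow> seq.neg Y U \<in> S"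
    and S_Inter: "\<U> \<subseteq> S \<Longrightarrow> seq_conds Y \<inter> \<Inter> \<U> \<in> S"
    and S_plain: "{p \<in> seq_conds Y. plain p \<in> entry i j} \<in> S"
    and S_twisted: "{p \<in> seq_conds Y. twisted lt p \<in> entry i j} \<in> S"
begin

abbreviation "P \<equiv> seq_conds Y"

text \<open>The Boolean value of "entry \<open>n\<close> of the generic sequence is
  \<open>a\<close>". Negating the refutations also admits short conditions when they already force
  the value, as when \<open>Y\<close> is \<open>{a}\<close>.\<close>

definition val :: "nat \<Rightarrow> 'u \<Rightarrow> 'u seq_cond set"
  where "val n a = seq.neg Y {(k, s, M) \<in> P. n < k \<and> s n \<noteq> a}"

definition below :: "nat \<Rightarrow> nat \<Rightarrow> 'u seq_cond set"
  where "below i j = seq.neg Y {(k, s, M) \<in> P. i < k \<and> j < k \<and> (s i, s j) \<notin> lt}"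

lemma regular_val: "seq.regular Y (val n a)"
  unfolding val_def by (rule seq.regular_neg) (auto simp: seq.downset_def seq_ext_iff)

lemma regular_below: "seq.regular Y (below i j)"
  unfolding below_def by (rule seq.regular_neg) (auto simp: seq.downset_def seq_ext_iff)

lemma mem_val: "\<lbrakk>(k, s, M) \<in> P; n < k\<rbrakk> \<Longrightarrow> (k, s, M) \<in> val n a \<longleftrightarrow> s n = a"
  by (auto simp: val_def seq.neg_def seq_ext_iff)

lemma mem_below: "\<lbrakk>(k, s, M) \<in> P; i < k; j < k\<rbrakk> \<Longrightarrow> (k, s, M) \<in> below i j \<longleftrightarrow> (s i, s j) \<in> lt"
  by (auto simp: below_def seq.neg_def seq_ext_iff)

lemma S_Int:
  assumes "U \<in> S" "V \<in> S" shows "U \<inter> V \<in> S"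
proof -
  have "P \<inter> \<Inter> {U, V} \<in> S" by (rule S_Inter) (use assms in simp)
  moreover have "P \<inter> \<Inter> {U, V} = U \<inter> V" using seq.regular_subset[OF S_regular[OF assms(1)]] by auto
  ultimately show ?thesis by simp
qed

text \<open>On conditions that reach beyond \<open>i\<close> and \<open>j\<close>, membership in
  \<open>U\<close> is a fixed truth function of three decided data. Boolean operations then act on
  the truth functions, and \<open>regular_eqI\<close> makes such conditions sufficient.\<close>

definition reads :: "nat \<Rightarrow> nat \<Rightarrow> 'u seq_cond set \<Rightarrow> ('u \<Rightarrow> 'u \<Rightarrow> bool \<Rightarrow> bool) \<Rightarrow> bool"
  where "reads i j U F \<longleftrightarrow>
    (\<forall>k s M. (k, s, M) \<in> P \<and> i < k \<and> j < k \<longrightarrow> ((k, s, M) \<in> U \<longleftrightarrow> F (s i) (s j) (M i j)))"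

lemma reads_neg: "reads i j U F \<Longrightarrow> reads i j (seq.neg Y U) (\<lambda>x y b. \<not> F x y b)"
  unfolding reads_def seq.neg_def by (fastforce simp: seq_ext_iff)

lemma reads_Int: "\<lbrakk>reads i j U F; reads i j V G\<rbrakk> \<Longrightarrow> reads i j (U \<inter> V) (\<lambda>x y b. F x y b \<and> G x y b)"
  unfolding reads_def by blast

lemma long_dense:
  assumes "p \<in> P" shows "\<exists>q\<in>P. seq_ext q p \<and> n < fst q"
proof -
  obtain k s M where p: "p = (k, s, M)" by (cases p)
  have "(max k (Suc n), s, M) \<in> P" "seq_ext (max k (Suc n), s, M) p"
    using assms by (auto simp: p seq_conds_def seq_ext_iff)
  then show ?thesis by (intro bexI[of _ "(max k (Suc n), s, M)"]) auto
qed

text \<open>The order of the entries is the symmetric difference of the two matrices.\<close>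

lemma below_in_S: "below i j \<in> S"
proof -
  define X where "X = {p \<in> P. plain p \<in> entry i j}"
  define Z where "Z = {p \<in> P. twisted lt p \<in> entry i j}"
  have XZ: "X \<in> S" "Z \<in> S" unfolding X_def Z_def by (rule S_plain S_twisted)+
  have rX: "reads i j X (\<lambda>x y b. b)" unfolding reads_def X_def by (auto simp: plain_def mem_entry)
  have rZ: "reads i j Z (\<lambda>x y b. b \<noteq> ((x, y) \<in> lt))"
    unfolding reads_def Z_def by (auto simp: twisted_def mem_entry)
  \<comment> \<open>A union of two differences in De Morgan form, as only \<open>neg\<close> and
    intersections are known to stay in \<open>S\<close>.\<close>
  let ?W = "seq.neg Y (seq.neg Y (X \<inter> seq.neg Y Z) \<inter> seq.neg Y (seq.neg Y X \<inter> Z))"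
  have W: "?W \<in> S" using XZ by (intro S_neg S_Int)
  have rW: "reads i j ?W (\<lambda>x y b. \<not> (\<not> (b \<and> \<not> (b \<noteq> ((x, y) \<in> lt))) \<and> \<not> (\<not> b \<and> b \<noteq> ((x, y) \<in> lt))))"
    using rX rZ by (intro reads_neg reads_Int)
  have "below i j = ?W"
  proof (rule seq.regular_eqI[where \<Delta> = "{p. i < fst p \<and> j < fst p}", OF regular_below S_regular[OF W]])
    fix p assume "p \<in> P"
    then show "\<exists>q\<in>P. seq_ext q p \<and> q \<in> {p. i < fst p \<and> j < fst p}"
      using long_dense[of p "max i j"] by auto
  next
    fix p assume p: "p \<in> P" "p \<in> {p. i < fst p \<and> j < fst p}"
    obtain k s M where p': "p = (k, s, M)" by (cases p)
    show "p \<in> below i j \<longleftrightarrow> p \<in> ?W"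
      using rW p mem_below[of k s M i j] unfolding reads_def p' by auto
  qed
  then show ?thesis using W by simp
qed

text \<open>Position \<open>k\<close> is the first one beyond the length, so any value may be put
  there; this density is what makes the generic sequence enumerate \<open>Y\<close>.\<close>

lemma append_value:
  assumes "(k, s, M) \<in> P" "a \<in> Y"
  shows "(Suc k, s(k := a), M) \<in> P" "seq_ext (Suc k, s(k := a), M) (k, s, M)"
  using assms by (auto simp: seq_conds_def seq_ext_iff)

lemma seq_ext_value: "\<lbrakk>seq_ext (k', s', M') (k, s, M); i < k\<rbrakk> \<Longrightarrow> s' i = s i \<and> i < k'"
  by (auto simp: seq_ext_iff)

text \<open>
  Every value is attained generically, so the entry \<open>m\<close> has value \<open>a\<close> iff the values of
  the entries below it are exactly the predecessors of \<open>a\<close>.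
\<close>

lemma val_eq:
  assumes a: "a \<in> Y"
  defines "J b m \<equiv> seq.neg Y (P \<inter> \<Inter> (range (\<lambda>n. seq.neg Y (val n b \<inter> below n m))))"
    and "K n m \<equiv> seq.neg Y (below n m \<inter> (P \<inter> \<Inter> ((\<lambda>b. seq.neg Y (val n b)) ` {b \<in> Y. (b, a) \<in> lt})))"
  assumes reg: "seq.regular Y (P \<inter> \<Inter> ((\<lambda>b. J b m) ` {b \<in> Y. (b, a) \<in> lt}) \<inter> (P \<inter> \<Inter> (range (\<lambda>n. K n m))))"
  shows "val m a = P \<inter> \<Inter> ((\<lambda>b. J b m) ` {b \<in> Y. (b, a) \<in> lt}) \<inter> (P \<inter> \<Inter> (range (\<lambda>n. K n m)))"
    (is "_ = ?R")
\<comment> \<open>\<open>J b m\<close> says that \<open>b\<close> occurs as some entry smaller than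
  entry \<open>m\<close>; \<open>K n m\<close> says that entry \<open>n\<close>, if smaller than
  entry \<open>m\<close>, is a predecessor of \<open>a\<close>.\<close>
proof (rule seq.regular_eqI[where \<Delta> = "{p. m < fst p}", OF regular_val reg])
  fix p assume "p \<in> P"
  then show "\<exists>q\<in>P. seq_ext q p \<and> q \<in> {p. m < fst p}" using long_dense[of p m] by auto
next
  fix p assume p: "p \<in> P" "p \<in> {p. m < fst p}"
  obtain k s M where p': "p = (k, s, M)" by (cases p)
  have k: "m < k" using p p' by simp
  have sm: "s m \<in> Y" using p p' by (auto simp: seq_conds_def)
  have irrefl: "(x, x) \<notin> lt" for x using wf_lt by simp
  show "p \<in> val m a \<longleftrightarrow> p \<in> ?R"
  proof
    assume "p \<in> val m a"
    then have sma: "s m = a" using mem_val[of k s M m a] p p' k by simp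
    \<comment> \<open>Below any extension of \<open>p\<close>, appending \<open>b\<close> at the end
      provides the required occurrence.\<close>
    have "p \<in> J b m" if b: "b \<in> Y" "(b, a) \<in> lt" for b
    proof -
      have "q \<notin> P \<inter> \<Inter> (range (\<lambda>n. seq.neg Y (val n b \<inter> below n m)))"
        if q: "q \<in> P" "seq_ext q p" for q
      proof -
        obtain k' s' M' where q': "q = (k', s', M')" by (cases q)
        have s'm: "s' m = a" "m < k'" using seq_ext_value[of k' s' M' k s M m] q q' p' k sma by auto
        let ?r = "(Suc k', s'(k' := b), M')"
        have r: "?r \<in> P" "seq_ext ?r q" using append_value[of k' s' M' b] q q' b by auto
        have "?r \<in> val k' b" using mem_val[OF r(1), of k' b] by simp
        moreover have "?r \<in> below k' m" using mem_below[OF r(1), of k' m] s'm b by simp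
        ultimately have "q \<notin> seq.neg Y (val k' b \<inter> below k' m)"
          unfolding seq.neg_def using r by blast
        then show ?thesis by blast
      qed
      then show ?thesis unfolding J_def seq.neg_def[of _ "P \<inter> _"] using p(1) by blast
    qed
    \<comment> \<open>A counterexample \<open>q\<close> excludes all predecessors of
      \<open>a\<close> as entry \<open>n\<close>, yet a longer condition decides that entry to be
      one of them.\<close>
    moreover have "p \<in> K n m" for n
    proof -
      have "q \<notin> below n m \<inter> (P \<inter> \<Inter> ((\<lambda>b. seq.neg Y (val n b)) ` {b \<in> Y. (b, a) \<in> lt}))"
        if q: "q \<in> P" "seq_ext q p" for q
      proof
        assume in': "q \<in> below n m \<inter> (P \<inter> \<Inter> ((\<lambda>b. seq.neg Y (val n b)) ` {b \<in> Y. (b, a) \<in> lt}))"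
        obtain r where r: "r \<in> P" "seq_ext r q" "n < fst r" using long_dense[OF q(1)] by blast
        obtain k' s' M' where r': "r = (k', s', M')" by (cases r)
        have "seq_ext r p" using seq.ext_trans[OF r(1) q(1) p(1) r(2) q(2)] .
        then have s'm: "s' m = a" "m < k'" using seq_ext_value[of k' s' M' k s M m] r' p' k sma by auto
        have "r \<in> below n m"
          using in' r q seq.regular_downset[OF regular_below] unfolding seq.downset_def by blast
        then have lt: "(s' n, a) \<in> lt" using mem_below[of k' s' M' n m] r r' s'm by simp
        have "s' n \<in> Y" using r r' by (auto simp: seq_conds_def)
        then have "q \<in> seq.neg Y (val n (s' n))" using in' lt by blast
        moreover have "r \<in> val n (s' n)" using mem_val[of k' s' M' n] r r' by simp
        ultimately show False unfolding seq.neg_def using r by blast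
      qed
      then show ?thesis unfolding K_def seq.neg_def[of _ "below n m \<inter> _"] using p(1) by blast
    qed
    ultimately show "p \<in> ?R" using p(1) by blast
  next
    assume R: "p \<in> ?R"
    \<comment> \<open>Otherwise \<open>J\<close> with \<open>b = s m\<close> would force the value
      \<open>s m\<close> to occur strictly below entry \<open>m\<close>, which has this same
      value.\<close>
    have "(s m, a) \<notin> lt"
    proof
      assume lt: "(s m, a) \<in> lt"
      then have "p \<in> J (s m) m" using R sm by blast
      then have "p \<notin> P \<inter> \<Inter> (range (\<lambda>n. seq.neg Y (val n (s m) \<inter> below n m)))"
        unfolding J_def seq.neg_def[of _ "P \<inter> _"] using p(1) seq.ext_refl by blast
      then obtain n where "p \<notin> seq.neg Y (val n (s m) \<inter> below n m)" using p(1) by blast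
      then obtain q where q: "q \<in> P" "seq_ext q p" "q \<in> val n (s m)" "q \<in> below n m"
        unfolding seq.neg_def using p(1) by blast
      obtain r where r: "r \<in> P" "seq_ext r q" "n < fst r" using long_dense[OF q(1)] by blast
      obtain k' s' M' where r': "r = (k', s', M')" by (cases r)
      have "r \<in> val n (s m)" "r \<in> below n m"
        using q r seq.regular_downset[OF regular_below] seq.regular_downset[OF regular_val]
        unfolding seq.downset_def by blast+
      moreover have "seq_ext r p" using seq.ext_trans[OF r(1) q(1) p(1) r(2) q(2)] .
      then have "s' m = s m" "m < k'" using seq_ext_value[of k' s' M' k s M m] r' p' k by auto
      ultimately show False
        using mem_val[of k' s' M' n "s m"] mem_below[of k' s' M' n m] r r' irrefl by simp
    qed
    \<comment> \<open>Otherwise appending \<open>a\<close> at position \<open>k\<close> creates an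
      entry below entry \<open>m\<close> that is not a predecessor of \<open>a\<close>, against
      \<open>K k m\<close>.\<close>
    moreover have "(a, s m) \<notin> lt"
    proof
      assume lt: "(a, s m) \<in> lt"
      let ?q = "(Suc k, s(k := a), M)"
      have q: "?q \<in> P" "seq_ext ?q p" using append_value[of k s M a] p p' a by auto
      have "?q \<in> below k m" using mem_below[OF q(1), of k m] lt k by simp
      moreover have "?q \<in> seq.neg Y (val k b)" if b: "(b, a) \<in> lt" for b
      proof -
        have "r \<notin> val k b" if r: "r \<in> P" "seq_ext r ?q" for r
        proof -
          obtain k' s' M' where r': "r = (k', s', M')" by (cases r)
          have "s' k = a" "k < k'" using seq_ext_value[of k' s' M' "Suc k" _ _ k] r r' by auto
          then show ?thesis using mem_val[of k' s' M' k b] r r' b irrefl by auto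
        qed
        then show ?thesis unfolding seq.neg_def using q(1) by blast
      qed
      ultimately have "?q \<in> below k m \<inter> (P \<inter> \<Inter> ((\<lambda>b. seq.neg Y (val k b)) ` {b \<in> Y. (b, a) \<in> lt}))"
        using q(1) by blast
      then have "p \<notin> K k m" unfolding K_def seq.neg_def[of _ "below k m \<inter> _"] using q by blast
      then show False using R by blast
    qed
    ultimately have "s m = a" using total_lt[OF sm a] by blast
    then show "p \<in> val m a" using mem_val[of k s M m a] p p' k by simp
  qed
qed

text \<open>The right-hand side of \<open>val_eq\<close> involves, besides \<open>below\<close>,
  only sets \<open>val n b\<close> with \<open>b\<close> preceding \<open>a\<close>, but for all
  positions \<open>n\<close>; hence \<open>m\<close> is generalised in the induction.\<close>

lemma val_in_S: "a \<in> Y \<Longrightarrow> val m a \<in> S"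
proof (induction a arbitrary: m rule: wf_induct_rule[OF wf_lt])
  case (1 a)
  have IH: "val n b \<in> S" if "b \<in> {b \<in> Y. (b, a) \<in> lt}" for n b using 1 that by blast
  let ?J = "\<lambda>b. seq.neg Y (P \<inter> \<Inter> (range (\<lambda>n. seq.neg Y (val n b \<inter> below n m))))"
  let ?K = "\<lambda>n. seq.neg Y (below n m \<inter> (P \<inter> \<Inter> ((\<lambda>b. seq.neg Y (val n b)) ` {b \<in> Y. (b, a) \<in> lt})))"
  have J: "?J b \<in> S" if "b \<in> {b \<in> Y. (b, a) \<in> lt}" for b
    using IH[OF that] below_in_S by (intro S_neg S_Inter image_subsetI S_Int)
  have K: "?K n \<in> S" for n
    using IH below_in_S by (intro S_neg S_Int S_Inter image_subsetI)
  have R: "P \<inter> \<Inter> (?J ` {b \<in> Y. (b, a) \<in> lt}) \<inter> (P \<inter> \<Inter> (range ?K)) \<in> S"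
    using J K by (intro S_Int S_Inter image_subsetI)
  show ?case using val_eq[OF 1(2) S_regular[OF R]] R by simp
qed

text \<open>The condition of length one with entry \<open>a\<close> already separates the values, so
  a single position yields \<open>|Y|\<close> elements of \<open>S\<close>.\<close>

lemma inj_on_val: "inj_on (val 0) Y"
proof (rule inj_onI)
  fix a b assume a: "a \<in> Y" and eq: "val 0 a = val 0 b"
  let ?p = "(1, \<lambda>_. a, \<lambda>_ _. False)"
  have p: "?p \<in> P" using a by (auto simp: seq_conds_def)
  show "a = b" using mem_val[OF p, of 0 a] mem_val[OF p, of 0 b] eq by simp
qed

lemma lepoll_S: "Y \<lesssim> S"
  unfolding lepoll_def using inj_on_val val_in_S by blast

end

section \<open>Smallness of the forcing notions and the cardinality contradiction\<close>

text \<open>With total functions the conditions number continuum many instead of countably many;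
  this is still small, since the universe exceeds \<open>nat\<close> and is closed under power
  sets.\<close>

lemma UNIV_matrix_cond_lesspoll:
  assumes u: "set_universe TYPE('u)"
  shows "(UNIV :: matrix_cond set) \<prec> (UNIV :: 'u set)"
proof -
  have nat: "(UNIV :: nat set) \<prec> (UNIV :: 'u set)" using u unfolding set_universe_def by simp
  have "(UNIV :: (nat \<Rightarrow> nat \<Rightarrow> bool) set) \<lesssim> Pow (UNIV \<times> UNIV :: (nat \<times> nat) set)"
    unfolding lepoll_def
    by (intro exI[of _ "\<lambda>M. {(i, j). M i j}"]) (auto simp: inj_on_def fun_eq_iff set_eq_iff)
  then have "(UNIV :: (nat \<Rightarrow> nat \<Rightarrow> bool) set) \<prec> (UNIV :: 'u set)"
    by (rule lesspoll_trans1) (intro set_universe_Pow[OF u] set_universe_Times[OF u] nat)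
  from set_universe_Times[OF u nat this] show ?thesis by simp
qed

lemma seq_conds_lesspoll:
  fixes Y :: "'u set"
  assumes u: "set_universe TYPE('u)" and Y: "small Y"
  shows "seq_conds Y \<prec> (UNIV :: 'u set)"
proof -
  have nat: "(UNIV :: nat set) \<prec> (UNIV :: 'u set)" using u unfolding set_universe_def by simp
  have "{s :: nat \<Rightarrow> 'u. range s \<subseteq> Y} \<lesssim> Pow ((UNIV :: nat set) \<times> Y)"
    unfolding lepoll_def
    by (intro exI[of _ "\<lambda>s. {(n, y). y = s n}"]) (auto simp: inj_on_def fun_eq_iff set_eq_iff)
  then have seqs: "{s :: nat \<Rightarrow> 'u. range s \<subseteq> Y} \<prec> (UNIV :: 'u set)"
    by (rule lesspoll_trans1)
      (intro set_universe_Pow[OF u] set_universe_Times[OF u] nat Y[unfolded small_def])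
  let ?P = "(UNIV :: matrix_cond set) \<times> {s :: nat \<Rightarrow> 'u. range s \<subseteq> Y}"
  have "seq_conds Y \<lesssim> ?P"
    unfolding lepoll_def seq_conds_def
    by (intro exI[of _ "\<lambda>(k, s, M). ((k, M), s)"]) (auto simp: inj_on_def)
  then show ?thesis
    by (rule lesspoll_trans1) (intro set_universe_Times[OF u] UNIV_matrix_cond_lesspoll[OF u] seqs)
qed

lemma ex_powerset_code:
  fixes X :: "'a set"
  assumes "set_universe TYPE('u)" "X \<prec> (UNIV :: 'u set)"
  shows "\<exists>code :: 'a set \<Rightarrow> 'u. inj_on code (Pow X)"
  using lesspoll_imp_lepoll[OF set_universe_Pow[OF assms]] unfolding lepoll_def by blast

lemma (in regular_algebra) small_RO:
  assumes "set_universe TYPE('u)" "P \<prec> (UNIV :: 'u set)"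
  shows "small (carrier RO)"
proof -
  have "carrier RO \<subseteq> code ` Pow P" unfolding RO_def using regular_subset by auto
  then have "carrier RO \<lesssim> Pow P" by (rule subset_image_lepoll)
  then show ?thesis unfolding small_def by (rule lesspoll_trans1[OF _ set_universe_Pow[OF assms]])
qed

text \<open>Cantor: a copy of the power set of \<open>C\<close> inside \<open>'u\<close>.\<close>

lemma lesspoll_small_set:
  fixes C :: "'u set"
  assumes u: "set_universe TYPE('u)" and C: "small C"
  shows "\<exists>Y :: 'u set. small Y \<and> C \<prec> Y"
proof -
  have P: "Pow C \<prec> (UNIV :: 'u set)" by (rule set_universe_Pow[OF u C[unfolded small_def]])
  then obtain f :: "'u set \<Rightarrow> 'u" where f: "inj_on f (Pow C)"
    using lesspoll_imp_lepoll[OF P] unfolding lepoll_def by blast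
  show ?thesis
  proof (intro exI conjI)
    show "small (f ` Pow C)" unfolding small_def using P f by simp
    show "C \<prec> f ` Pow C" using lesspoll_Pow_self f by simp
  qed
qed

lemma ex_wf_total: "\<exists>lt :: ('a \<times> 'a) set. wf lt \<and> (\<forall>x y. x \<noteq> y \<longrightarrow> (x, y) \<in> lt \<or> (y, x) \<in> lt)"
proof -
  obtain r :: "('a \<times> 'a) set" where r: "well_order_on UNIV r" using well_order_on by blast
  then have "wf (r - Id)" "\<forall>x y. x \<noteq> y \<longrightarrow> (x, y) \<in> r - Id \<or> (y, x) \<in> r - Id"
    unfolding well_order_on_def linear_order_on_def total_on_def by auto
  then show ?thesis by blast
qed

lemma coproduct_not_small:
  fixes codeQ :: "matrix_cond set \<Rightarrow> 'u"
  assumes u: "set_universe TYPE('u)" and codeQ: "regular_algebra UNIV matrix_ext codeQ"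
    and cop: "is_coproduct (regular_algebra.RO UNIV matrix_ext codeQ)
      (regular_algebra.RO UNIV matrix_ext codeQ) C i j"
  shows "\<not> small (carrier C)"
proof
  assume C: "small (carrier C)"
  interpret Q: regular_algebra UNIV matrix_ext codeQ by fact
  \<comment> \<open>\<open>Y\<close> is chosen after \<open>C\<close>; this is possible because the
    Cohen algebra does not depend on it.\<close>
  obtain Y :: "'u set" where Y: "small Y" "carrier C \<prec> Y"
    using lesspoll_small_set[OF u C] by (elim exE conjE)
  obtain lt :: "('u \<times> 'u) set"
    where lt: "wf lt" "\<forall>x y. x \<noteq> y \<longrightarrow> (x, y) \<in> lt \<or> (y, x) \<in> lt"
    using ex_wf_total[where 'a = 'u] by (elim exE conjE)
  obtain codeP :: "'u seq_cond set \<Rightarrow> 'u" where codeP: "inj_on codeP (Pow (seq_conds Y))"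
    using ex_powerset_code[OF u seq_conds_lesspoll[OF u Y(1)]] by blast
  interpret P: regular_algebra "seq_conds Y" seq_ext codeP
    by unfold_locales (rule Q.infinite_UNIV, rule codeP)
  interpret f: regular_algebra_projection "seq_conds Y" seq_ext UNIV matrix_ext plain codeP codeQ
    by (intro regular_algebra_projection.intro plain_projection P.regular_algebra_axioms codeQ)
  interpret g: regular_algebra_projection "seq_conds Y" seq_ext UNIV matrix_ext "twisted lt" codeP codeQ
    by (intro regular_algebra_projection.intro twisted_projection P.regular_algebra_axioms codeQ)
  have cblC: "complete_boolean_lattice C" and i: "i \<in> complete_boolean_hom Q.RO C"
    and j: "j \<in> complete_boolean_hom Q.RO C"
    using cop unfolding is_coproduct_def by auto
  interpret C: complemented_order C "complement C"
    by (rule complete_boolean_lattice_imp_complemented_order[OF Q.infinite_UNIV cblC])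
  obtain h where h: "h \<in> complete_boolean_hom C P.RO"
    and hi: "\<forall>x\<in>carrier Q.RO. h (i x) = f.pullback x"
    and hj: "\<forall>x\<in>carrier Q.RO. h (j x) = g.pullback x"
    using cop P.RO.complete_boolean_lattice_axioms f.pullback_hom g.pullback_hom
    unfolding is_coproduct_def by blast
  define S where "S = (\<lambda>z. P.decode (h z)) ` carrier C"
  have h_closed: "h z \<in> carrier P.RO" if "z \<in> carrier C" for z
    using h that unfolding complete_boolean_hom_def by blast
  have i_closed: "i x \<in> carrier C" and j_closed: "j x \<in> carrier C" if "x \<in> carrier Q.RO" for x
    using i j that unfolding complete_boolean_hom_def by blast+
  have entry: "codeQ (entry m n) \<in> carrier Q.RO" "Q.decode (codeQ (entry m n)) = entry m n" for m n
    by (rule Q.code_closed[OF regular_entry], rule Q.decode_code[OF subset_UNIV])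
  interpret generated_family Y lt S
  proof
    show "wf lt" by (rule lt)
    show "(x, y) \<in> lt \<or> (y, x) \<in> lt" if "x \<noteq> y" for x y using lt that by blast
    show "seq.regular Y U" if "U \<in> S" for U
      using that P.decode_regular[OF h_closed] unfolding S_def by auto
    show "seq.neg Y U \<in> S" if U: "U \<in> S" for U
    proof -
      obtain z where z: "z \<in> carrier C" "U = P.decode (h z)" using U unfolding S_def by auto
      have "h (complement C z) = P.cpl (h z)"
        by (rule complete_boolean_hom_complement[OF C.complemented_order_axioms
              P.RO.complemented_order_axioms h z(1)])
      then have "seq.neg Y U = P.decode (h (complement C z))"
        using P.decode_cpl z by simp
      then show ?thesis unfolding S_def using C.N_closed[OF z(1)] by blast
    qed
    show "seq_conds Y \<inter> \<Inter> \<U> \<in> S" if "\<U> \<subseteq> S" for \<U>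
    proof -
      \<comment> \<open>As \<open>C\<close> is assumed small, the full preimage of the family is
        small, so \<open>h\<close> preserves its infimum and the image is closed under arbitrary
        meets.\<close>
      define Z where "Z = {z \<in> carrier C. P.decode (h z) \<in> \<U>}"
      have Z: "Z \<subseteq> carrier C" "small Z" unfolding Z_def using small_subset[OF C] by auto
      have im: "P.decode ` h ` Z = \<U>" using that unfolding S_def Z_def by auto
      have hZ: "h ` Z \<subseteq> carrier P.RO" using Z h_closed by blast
      have "h (\<Sqinter>\<^bsub>C\<^esub> Z) = \<Sqinter>\<^bsub>P.RO\<^esub> (h ` Z)" using h Z unfolding complete_boolean_hom_def by blast
      then have "P.decode (h (\<Sqinter>\<^bsub>C\<^esub> Z)) = seq_conds Y \<inter> \<Inter> \<U>" using P.decode_inf[OF hZ] im by simp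
      moreover have "\<Sqinter>\<^bsub>C\<^esub> Z \<in> carrier C" using C.is_glb_inf[OF Z] by (rule greatest_closed)
      ultimately show ?thesis unfolding S_def by blast
    qed
    show "{p \<in> seq_conds Y. plain p \<in> entry m n} \<in> S" for m n
    proof -
      have "P.decode (h (i (codeQ (entry m n)))) = {p \<in> seq_conds Y. plain p \<in> entry m n}"
        using hi entry f.decode_pullback by (simp add: f.pre_def)
      then show ?thesis unfolding S_def using i_closed[OF entry(1)] by blast
    qed
    show "{p \<in> seq_conds Y. twisted lt p \<in> entry m n} \<in> S" for m n
    proof -
      have "P.decode (h (j (codeQ (entry m n)))) = {p \<in> seq_conds Y. twisted lt p \<in> entry m n}"
        using hj entry g.decode_pullback by (simp add: g.pre_def)
      then show ?thesis unfolding S_def using j_closed[OF entry(1)] by blast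
    qed
  qed
  have "S \<lesssim> carrier C" unfolding S_def by (rule image_lepoll)
  with lepoll_S have "Y \<lesssim> carrier C" by (rule lepoll_trans)
  then have "Y \<prec> Y" using Y(2) by (rule lesspoll_trans1)
  then show False by simp
qed

text \<open>The existence of a coproduct is part of the claim, so that the statement about all
  coproducts is not vacuous.\<close>

theorem theorem5p1:
  assumes "set_universe TYPE('u)"
  shows "\<exists>B :: 'u gorder. complete_boolean_lattice B \<and> small (carrier B) \<and>
    (\<exists>C i j. is_coproduct B B C i j) \<and>
    (\<forall>C i j. is_coproduct B B C i j \<longrightarrow> \<not> small (carrier C))"
proof -
  obtain code :: "matrix_cond set \<Rightarrow> 'u" where code: "inj_on code (Pow UNIV)"
    using ex_powerset_code[OF assms UNIV_matrix_cond_lesspoll[OF assms]] by blast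
  interpret Q: regular_algebra UNIV matrix_ext code
    by unfold_locales (rule set_universe_infinite[OF assms], rule code)
  note cbl = Q.RO.complete_boolean_lattice_axioms
  show ?thesis
  proof (rule exI[of _ Q.RO], intro conjI allI impI)
    show "complete_boolean_lattice Q.RO" by (rule cbl)
    show "small (carrier Q.RO)" by (rule Q.small_RO[OF assms UNIV_matrix_cond_lesspoll[OF assms]])
    show "\<exists>C i j. is_coproduct Q.RO Q.RO C i j" by (rule coproduct_exists[OF assms cbl cbl])
    show "\<not> small (carrier C)" if "is_coproduct Q.RO Q.RO C i j" for C i j
      by (rule coproduct_not_small[OF assms Q.regular_algebra_axioms that])
  qed
qed

end
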